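(* Let $m,n$ be positive integers with $n = 2m-2$. Then $$\tilde H_{\nu_{m,n}}(M_{m,n}) \cong \mathbb{Z}^{c_{m-1}},$$ where $c_k = \frac{1}{k+1}\binom{2k}{k}$ denotes the $k$th Catalan number.
   Context: For positive integers $m,n$, let $[m]=\{1,\dots,m\}$ and $[n]'=\{1',\dots,n'\}$. The chessboard complex $M_{m,n}$ is the abstract simplicial complex whose vertices are the edges of the complete bipartite graph with parts $[m]$ and $[n]'$ and whose faces are the sets of pairwise disjoint edges (matchings). $\nu_{m,n} = \min\{m,n,\lfloor \frac{m+n+1}{3}\rfloor\}-1$. $\tilde H_*$ denotes reduced simplicial homology with integer coefficients. *)

theory Defs
  imports "HOL-Algebra.Algebra"
begin

section \<open>Reduced simplicial homology with integer coefficients\<close>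

text \<open>
  An abstract simplicial complex is given by its set \<open>\<Delta>\<close> of (finite) faces, the empty face
  included.  The parameter \<open>lt\<close> is a strict linear order on the vertices.  It orients the
  faces, and up to isomorphism the homology does not depend on it.
\<close>

definition simplicial_chain_group :: "'a set set \<Rightarrow> int \<Rightarrow> ('a set \<Rightarrow>\<^sub>0 int) monoid" where
  "simplicial_chain_group \<Delta> p = free_Abelian_group {\<sigma> \<in> \<Delta>. int (card \<sigma>) = p + 1}"

text \<open>
  If \<open>\<sigma> = {v\<^sub>0, \<dots>, v\<^sub>p}\<close> is listed in increasing order, then \<open>v\<^sub>i\<close> has exactly \<open>i\<close> smaller
  vertices in \<open>\<sigma>\<close>, so this is the usual alternating sum of the facets \<open>\<sigma> - {v\<^sub>i}\<close>.  On vertices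
  it is the augmentation onto the group in degree \<open>-1\<close>, which is generated by the empty face.
\<close>

definition simplicial_boundary ::
    "('a \<Rightarrow> 'a \<Rightarrow> bool) \<Rightarrow> ('a set \<Rightarrow>\<^sub>0 int) \<Rightarrow> ('a set \<Rightarrow>\<^sub>0 int)" where
  "simplicial_boundary lt =
     frag_extend (\<lambda>\<sigma>. \<Sum>v\<in>\<sigma>. frag_cmul ((- 1) ^ card {u \<in> \<sigma>. lt u v}) (frag_of (\<sigma> - {v})))"

definition simplicial_cycle_group ::
    "('a \<Rightarrow> 'a \<Rightarrow> bool) \<Rightarrow> 'a set set \<Rightarrow> int \<Rightarrow> ('a set \<Rightarrow>\<^sub>0 int) monoid" where
  "simplicial_cycle_group lt \<Delta> p =
     subgroup_generated (simplicial_chain_group \<Delta> p)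
       (kernel (simplicial_chain_group \<Delta> p) (simplicial_chain_group \<Delta> (p - 1))
          (simplicial_boundary lt))"

definition simplicial_boundary_set ::
    "('a \<Rightarrow> 'a \<Rightarrow> bool) \<Rightarrow> 'a set set \<Rightarrow> int \<Rightarrow> ('a set \<Rightarrow>\<^sub>0 int) set" where
  "simplicial_boundary_set lt \<Delta> p =
     simplicial_boundary lt ` carrier (simplicial_chain_group \<Delta> (p + 1))"

definition reduced_simplicial_homology ::
    "('a \<Rightarrow> 'a \<Rightarrow> bool) \<Rightarrow> 'a set set \<Rightarrow> int \<Rightarrow> ('a set \<Rightarrow>\<^sub>0 int) set monoid" where
  "reduced_simplicial_homology lt \<Delta> p =
     simplicial_cycle_group lt \<Delta> p Mod simplicial_boundary_set lt \<Delta> p"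


section \<open>Chessboard complexes\<close>

text \<open>
  The pair \<open>(i, j)\<close> stands for the edge \<open>i j'\<close> of the complete bipartite graph with parts
  \<open>{1, \<dots>, m}\<close> and \<open>{1', \<dots>, n'}\<close>.
\<close>

definition chessboard_complex :: "nat \<Rightarrow> nat \<Rightarrow> (nat \<times> nat) set set" where
  "chessboard_complex m n =
     {\<sigma>. \<sigma> \<subseteq> {1..m} \<times> {1..n} \<and> pairwise (\<lambda>(i, j) (k, l). i \<noteq> k \<and> j \<noteq> l) \<sigma>}"

text \<open>
  The lexicographic order is spelled out because the order instances for pairs in
  \<open>Product_Lexorder\<close> and \<open>Product_Order\<close> (the latter being used by HOL-Analysis) are incompatible.
\<close>

definition edge_less :: "nat \<times> nat \<Rightarrow> nat \<times> nat \<Rightarrow> bool" where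
  "edge_less = (\<lambda>(i, j) (k, l). i < k \<or> i = k \<and> j < l)"

lemma edge_less_strict_linear:
  "\<not> edge_less e e"
  "edge_less e f \<Longrightarrow> edge_less f g \<Longrightarrow> edge_less e g"
  "e \<noteq> f \<Longrightarrow> edge_less e f \<or> edge_less f e"
  by (auto simp: edge_less_def)

definition chessboard_homology :: "int \<Rightarrow> nat \<Rightarrow> nat \<Rightarrow> ((nat \<times> nat) set \<Rightarrow>\<^sub>0 int) set monoid" where
  "chessboard_homology p m n = reduced_simplicial_homology edge_less (chessboard_complex m n) p"

definition nu :: "nat \<Rightarrow> nat \<Rightarrow> int" where
  "nu m n = int (min (min m n) ((m + n + 1) div 3)) - 1"

definition catalan :: "nat \<Rightarrow> nat" where
  "catalan k = (2 * k choose k) div (k + 1)"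

lemma catalan_exact: "(k + 1) * catalan k = 2 * k choose k"
proof -
  have "(k + 1) * (2 * k choose (k + 1)) = k * (2 * k choose k)"
    using binomial_absorb_comp[of "2 * k" k] binomial_absorption[of k "2 * k"]
    by auto
  then have "(k + 1) dvd k * (2 * k choose k)"
    by (metis dvd_triv_left)
  moreover have "coprime (k + 1) k"
    by simp
  ultimately have "(k + 1) dvd (2 * k choose k)"
    by (simp only: coprime_dvd_mult_right_iff)
  then show ?thesis
    by (simp only: catalan_def dvd_mult_div_cancel)
qed

end

theory Submission
  imports Defs "HOL-Computational_Algebra.Group_Closure"
begin

text \<open>
  Put \<open>m = k + 1\<close> and \<open>n = 2 k\<close>, so that the degree in question is \<open>k - 1\<close>: the cycles are
  combinations of placements of \<open>k\<close> non-attacking rooks on a board with \<open>k + 1\<close> rows and \<open>2 k\<close>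
  columns, one row staying empty. An explicit basis of the homology is indexed by the standard
  Young tableaux with two columns of length \<open>k\<close>, of which there are a Catalan number.

  \<^bold>\<open>The spheres.\<close> In one row, two columns \<open>a\<close> and \<open>b\<close> form a \<open>0\<close>-sphere, with fundamental cycle
  \<open>b - a\<close>. Using the rows \<open>1, \<dots>, k\<close> and a perfect matching of the columns by pairs
  \<open>(a\<^sub>1, b\<^sub>1), \<dots>, (a\<^sub>k, b\<^sub>k)\<close>, the join of these \<open>0\<close>-spheres is a \<open>(k - 1)\<close>-sphere in the complex.

  \<^bold>\<open>They generate.\<close> If \<open>2 |S| \<le> |C| + 1\<close>, then the chessboard complex on the rows \<open>S\<close> and columns
  \<open>C\<close> is acyclic below its top dimension (\<open>rook_cycles_bound\<close>). This has three uses. A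
  \<open>(k - 1)\<close>-cycle on \<open>k + 1\<close> rows can be pushed off the last row. A top-dimensional cycle on a board
  with more than \<open>2 |S|\<close> columns is a sum of cycles each missing a column. Hence, on a board with
  exactly \<open>2 |S|\<close> columns, the top-dimensional cycles are spanned by suspensions of top-dimensional
  cycles with one row and two columns less (\<open>top_cycles_generated_by_suspensions\<close>), and by induction
  by the spheres above.

  \<^bold>\<open>Straightening.\<close> A cycle on the rows \<open>1, \<dots>, k\<close> that misses a column \<open>j\<close> bounds: it is the boundary
  of its cone with apex \<open>(k + 1, j)\<close>. Two kinds of relations follow, because hexagons (two rows,
  three columns) leave one of four columns free: the pairs may be permuted among the rows, and
  writing \<open>x\<^sub>b - x\<^sub>a\<close> for a pair, the identity
  \<open>(x\<^sub>d - x\<^sub>a) (x\<^sub>c - x\<^sub>b) = (x\<^sub>c - x\<^sub>a) (x\<^sub>d - x\<^sub>b) - (x\<^sub>b - x\<^sub>a) (x\<^sub>d - x\<^sub>c)\<close> resolves nested pairs. What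
  remains are the matchings whose openers and closers are both increasing. They are determined
  by the set of closers, a ballot set.

  \<^bold>\<open>They are independent.\<close> Forgetting the rows, up to a sign depending on the empty row, maps a sphere
  to the Specht polynomial \<open>\<Prod>\<^sub>i (x\<^bsub>b\<^sub>i\<^esub> - x\<^bsub>a\<^sub>i\<^esub>)\<close>. Pairing with the coefficients of such a polynomial
  kills boundaries (\<open>matching_cocycle_boundary\<close>), so a homology relation between the spheres gives
  a linear combination of Specht polynomials orthogonal to all of them, in particular to
  itself. It is zero, and comparing leading monomials all coefficients vanish
  (\<open>ballot_spheres_independent\<close>).
\<close>

section \<open>Generated subgroups\<close>

lemma group_closure_map:
  fixes f :: "'a::ab_group_add \<Rightarrow> 'b::ab_group_add"
  assumes "x \<in> group_closure G" "f 0 = 0" "\<And>x y. f (x - y) = f x - f y"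
    and "\<And>x. x \<in> G \<Longrightarrow> f x \<in> group_closure Y"
  shows "f x \<in> group_closure Y"
  using assms(1)
  by (induction rule: group_closure.induct) (auto simp: assms(2-) intro: group_closure.diff)

lemma group_closure_cmul:
  "x \<in> group_closure G \<Longrightarrow> frag_cmul n x \<in> group_closure G"
proof (induction n rule: int_induct[where k = 0])
  case (step1 i)
  then show ?case by (simp add: frag_cmul_distrib group_closure_add)
next
  case (step2 i)
  then show ?case by (simp add: frag_cmul_diff_distrib group_closure.diff)
qed simp

lemma group_closure_mono: "x \<in> group_closure A \<Longrightarrow> A \<subseteq> B \<Longrightarrow> x \<in> group_closure B"
  for A B :: "'a::ab_group_add set"
  by (induction rule: group_closure.induct) (auto intro: group_closure.intros)

lemma group_closure_sums:
  fixes f :: "'a \<Rightarrow> 'b::ab_group_add"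
  shows "(\<And>i. i \<in> J \<Longrightarrow> f i \<in> group_closure G) \<Longrightarrow> sum f J \<in> group_closure G"
  by (induction J rule: infinite_finite_induct) (auto intro: group_closure_add)

lemma frag_cmul_neg: "frag_cmul n (- x) = frag_cmul (- n) x"
  by (rule poly_mapping_eqI) simp

section \<open>Exterior calculus of vertices\<close>

type_synonym chain = "(nat \<times> nat) set \<Rightarrow>\<^sub>0 int"

abbreviation bd :: "chain \<Rightarrow> chain" where
  "bd \<equiv> simplicial_boundary edge_less"

definition vsign :: "nat \<times> nat \<Rightarrow> (nat \<times> nat) set \<Rightarrow> int" where
  "vsign v \<sigma> = (- 1) ^ card {u \<in> \<sigma>. edge_less u v}"

text \<open>
  Chains of the full simplex on all vertices form an exterior algebra. In it, \<open>wedge v\<close> is the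
  exterior product with \<open>v\<close> (the cone with apex \<open>v\<close>) and \<open>slice v\<close> the contraction with the dual of
  \<open>v\<close>, which extracts the link of \<open>v\<close>; the boundary is the sum of all contractions. The usual
  (anti-)commutation rules replace all further bookkeeping of signs.
\<close>

definition wedge :: "nat \<times> nat \<Rightarrow> chain \<Rightarrow> chain" where
  "wedge v = frag_extend (\<lambda>\<sigma>. if v \<in> \<sigma> then 0 else frag_cmul (vsign v \<sigma>) (frag_of (insert v \<sigma>)))"

definition slice :: "nat \<times> nat \<Rightarrow> chain \<Rightarrow> chain" where
  "slice v = frag_extend (\<lambda>\<sigma>. if v \<in> \<sigma> then frag_cmul (vsign v \<sigma>) (frag_of (\<sigma> - {v})) else 0)"

lemma bd_linear:
  "bd 0 = 0" "bd (x + y) = bd x + bd y" "bd (x - y) = bd x - bd y" "bd (- x) = - bd x"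
  "finite I \<Longrightarrow> bd (sum f I) = (\<Sum>i\<in>I. bd (f i))"
  unfolding simplicial_boundary_def
  by (simp_all add: frag_extend_add frag_extend_diff frag_extend_minus frag_extend_sum comp_def)

lemma wedge_linear:
  "wedge v 0 = 0" "wedge v (x + y) = wedge v x + wedge v y" "wedge v (x - y) = wedge v x - wedge v y"
  "wedge v (- x) = - wedge v x" "wedge v (frag_cmul n x) = frag_cmul n (wedge v x)"
  "finite I \<Longrightarrow> wedge v (sum f I) = (\<Sum>i\<in>I. wedge v (f i))"
  unfolding wedge_def
  by (simp_all add: frag_extend_add frag_extend_diff frag_extend_minus frag_extend_cmul
      frag_extend_sum comp_def)

lemma slice_linear:
  "slice v 0 = 0" "slice v (x + y) = slice v x + slice v y" "slice v (x - y) = slice v x - slice v y"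
  "slice v (- x) = - slice v x" "slice v (frag_cmul n x) = frag_cmul n (slice v x)"
  "finite I \<Longrightarrow> slice v (sum f I) = (\<Sum>i\<in>I. slice v (f i))"
  unfolding slice_def
  by (simp_all add: frag_extend_add frag_extend_diff frag_extend_minus frag_extend_cmul
      frag_extend_sum comp_def)

lemma bd_of: "bd (frag_of \<sigma>) = (\<Sum>v\<in>\<sigma>. frag_cmul (vsign v \<sigma>) (frag_of (\<sigma> - {v})))"
  by (simp add: simplicial_boundary_def vsign_def)

lemma wedge_of:
  "wedge v (frag_of \<sigma>) = (if v \<in> \<sigma> then 0 else frag_cmul (vsign v \<sigma>) (frag_of (insert v \<sigma>)))"
  by (simp add: wedge_def)

lemma slice_of:
  "slice v (frag_of \<sigma>) = (if v \<in> \<sigma> then frag_cmul (vsign v \<sigma>) (frag_of (\<sigma> - {v})) else 0)"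
  by (simp add: slice_def)

lemma vsign_square [simp]: "vsign v \<sigma> * vsign v \<sigma> = 1"
  by (simp add: vsign_def flip: power_mult_distrib)

lemma vsign_insert:
  assumes "finite \<sigma>" "u \<notin> \<sigma>"
  shows "vsign v (insert u \<sigma>) = (if edge_less u v then - vsign v \<sigma> else vsign v \<sigma>)"
proof -
  have "{w \<in> insert u \<sigma>. edge_less w v} =
      (if edge_less u v then insert u {w \<in> \<sigma>. edge_less w v} else {w \<in> \<sigma>. edge_less w v})"
    by auto
  then show ?thesis
    using assms by (simp add: vsign_def)
qed

lemma vsign_remove_self [simp]: "vsign v (\<sigma> - {v}) = vsign v \<sigma>"
proof -
  have "{u \<in> \<sigma> - {v}. edge_less u v} = {u \<in> \<sigma>. edge_less u v}"
    using edge_less_strict_linear(1) by auto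
  then show ?thesis by (simp add: vsign_def)
qed

lemma vsign_insert_self [simp]: "vsign v (insert v \<sigma>) = vsign v \<sigma>"
  using vsign_remove_self[of v "insert v \<sigma>"] vsign_remove_self[of v \<sigma>]
  by simp

lemma vsign_swap:
  assumes "finite \<sigma>" "u \<notin> \<sigma>" "v \<notin> \<sigma>" "u \<noteq> v"
  shows "vsign u (insert v \<sigma>) * vsign v \<sigma> = - (vsign v (insert u \<sigma>) * vsign u \<sigma>)"
    and "vsign v (insert u \<sigma>) * vsign u (insert v (insert u \<sigma>)) = - (vsign u \<sigma> * vsign v \<sigma>)"
proof -
  have "edge_less u v \<longleftrightarrow> \<not> edge_less v u"
    using edge_less_strict_linear \<open>u \<noteq> v\<close> by metis
  moreover have "insert v (insert u \<sigma>) = insert u (insert v \<sigma>)"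
    by auto
  ultimately show "vsign u (insert v \<sigma>) * vsign v \<sigma> = - (vsign v (insert u \<sigma>) * vsign u \<sigma>)"
    and "vsign v (insert u \<sigma>) * vsign u (insert v (insert u \<sigma>)) = - (vsign u \<sigma> * vsign v \<sigma>)"
    using assms by (simp_all add: vsign_insert)
qed

text \<open>
  The sign \<open>vsign\<close> counts smaller vertices, which is meaningful for finite cells only.
\<close>

definition finite_cells :: "chain \<Rightarrow> bool" where
  "finite_cells c \<longleftrightarrow> (\<forall>\<sigma>\<in>Poly_Mapping.keys c. finite \<sigma>)"

lemma finite_cells_induct [consumes 1, case_names zero of diff]:
  assumes "finite_cells c" "P 0" "\<And>\<sigma>. finite \<sigma> \<Longrightarrow> P (frag_of \<sigma>)"
    "\<And>a b. P a \<Longrightarrow> P b \<Longrightarrow> P (a - b)"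
  shows "P c"
  using assms(1) frag_induction[of c "{\<sigma>. finite \<sigma>}" P] assms(2-)
  by (auto simp: finite_cells_def)

lemma wedge_wedge:
  assumes "finite_cells c"
  shows "wedge u (wedge v c) = - wedge v (wedge u c)"
  using assms
proof (induction rule: finite_cells_induct)
  case (of \<sigma>)
  show ?case
    using of vsign_swap(1)[of \<sigma> u v]
    by (simp add: wedge_of wedge_linear insert_commute mult.commute)
qed (simp_all add: wedge_linear)

lemma slice_wedge_self:
  assumes "finite_cells c"
  shows "slice v (wedge v c) = c - wedge v (slice v c)"
  using assms
proof (induction rule: finite_cells_induct)
  case (of \<sigma>)
  show ?case
    using of
    by (simp add: wedge_of slice_of wedge_linear slice_linear insert_absorb)
qed (simp_all add: wedge_linear slice_linear)

lemma slice_wedge: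
  assumes "finite_cells c" "u \<noteq> v"
  shows "slice u (wedge v c) = - wedge v (slice u c)"
  using assms
proof (induction rule: finite_cells_induct)
  case (of \<sigma>)
  show ?case
  proof (cases "u \<in> \<sigma> \<and> v \<notin> \<sigma>")
    case True
    then obtain \<tau> where \<tau>: "\<sigma> = insert u \<tau>" "u \<notin> \<tau>" "v \<notin> \<tau>" "finite \<tau>"
      using of True by (intro that[of "\<sigma> - {u}"]) auto
    have e: "insert v (insert u \<tau>) - {u} = insert v \<tau>"
      using \<tau> \<open>u \<noteq> v\<close> by auto
    have "vsign v (insert u \<tau>) * vsign u (insert v (insert u \<tau>)) = - (vsign u \<tau> * vsign v \<tau>)"
      using vsign_swap(2)[of \<tau> u v] \<tau> \<open>u \<noteq> v\<close> by simp
    then show ?thesis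
      using \<tau> \<open>u \<noteq> v\<close> by (simp add: wedge_of slice_of wedge_linear slice_linear e)
  next
    case False
    then show ?thesis
      using \<open>u \<noteq> v\<close> by (auto simp: wedge_of slice_of wedge_linear slice_linear)
  qed
qed (simp_all add: wedge_linear slice_linear)

text \<open>
  Coning off is a contracting homotopy of the full simplex.
\<close>

lemma bd_wedge:
  assumes "finite_cells c"
  shows "bd (wedge v c) = c - wedge v (bd c)"
  using assms
proof (induction rule: finite_cells_induct)
  case (of \<sigma>)
  show ?case
  proof (cases "v \<in> \<sigma>")
    case True
    have "wedge v (bd (frag_of \<sigma>)) =
        (\<Sum>u\<in>\<sigma>. if u = v then frag_of \<sigma> else 0)"
      unfolding bd_of wedge_linear(6)[OF of]
      using True by (intro sum.cong) (auto simp: wedge_linear wedge_of insert_absorb)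
    also have "\<dots> = frag_of \<sigma>"
      using True of by simp
    finally show ?thesis
      using True by (simp add: wedge_of bd_linear)
  next
    case False
    have eq: "frag_cmul (vsign v \<sigma>) (frag_cmul (vsign u (insert v \<sigma>)) (frag_of (insert v \<sigma> - {u})))
       = - wedge v (frag_cmul (vsign u \<sigma>) (frag_of (\<sigma> - {u})))" if u: "u \<in> \<sigma>" for u
    proof -
      obtain \<tau> where \<tau>: "\<sigma> = insert u \<tau>" "u \<notin> \<tau>" "v \<notin> \<tau>" "finite \<tau>" "u \<noteq> v"
        using of u False by (intro that[of "\<sigma> - {u}"]) auto
      have e: "insert v (insert u \<tau>) - {u} = insert v \<tau>"
        using \<tau> by auto
      have "vsign v (insert u \<tau>) * vsign u (insert v (insert u \<tau>)) = - (vsign u \<tau> * vsign v \<tau>)"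
        using vsign_swap(2)[of \<tau> u v] \<tau> by simp
      then show ?thesis
        using \<tau> by (simp add: wedge_of wedge_linear e)
    qed
    have "bd (wedge v (frag_of \<sigma>)) = frag_cmul (vsign v \<sigma>) (bd (frag_of (insert v \<sigma>)))"
      using False by (simp add: wedge_of simplicial_boundary_def frag_extend_cmul)
    also have "\<dots> = (\<Sum>u\<in>insert v \<sigma>. frag_cmul (vsign v \<sigma>)
         (frag_cmul (vsign u (insert v \<sigma>)) (frag_of (insert v \<sigma> - {u}))))"
      unfolding bd_of using of by (subst frag_cmul_sum) auto
    also have "\<dots> = frag_of \<sigma> - wedge v (bd (frag_of \<sigma>))"
      unfolding bd_of wedge_linear(6)[OF of]
      using False of by (simp add: eq sum_negf del: frag_cmul_cmul) (simp)
    finally show ?thesis .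
  qed
qed (simp_all add: wedge_linear bd_linear)

text \<open>
  Contracting and multiplying again projects onto the cells that contain \<open>v\<close>.
\<close>

lemma wedge_slice_lookup:
  "Poly_Mapping.lookup (wedge v (slice v c)) \<sigma> = (if v \<in> \<sigma> then Poly_Mapping.lookup c \<sigma> else 0)"
proof (induction c rule: frag_induction[OF subset_UNIV])
  case (2 \<tau>)
  show ?case
    by (auto simp: slice_of wedge_linear wedge_of insert_absorb lookup_single when_def)
qed (simp_all add: wedge_linear slice_linear lookup_minus)

lemma slice_eq_0_iff: "slice v c = 0 \<longleftrightarrow> (\<forall>\<sigma>\<in>Poly_Mapping.keys c. v \<notin> \<sigma>)"
proof
  assume "slice v c = 0"
  then have "Poly_Mapping.lookup (wedge v (slice v c)) \<sigma> = 0" for \<sigma>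
    by (simp add: wedge_linear)
  then show "\<forall>\<sigma>\<in>Poly_Mapping.keys c. v \<notin> \<sigma>"
    by (metis (full_types) wedge_slice_lookup in_keys_iff)
next
  assume "\<forall>\<sigma>\<in>Poly_Mapping.keys c. v \<notin> \<sigma>"
  then show "slice v c = 0"
    by (simp add: slice_def frag_extend_eq_0)
qed

lemma keys_wedge:
  assumes "\<tau> \<in> Poly_Mapping.keys (wedge v c)"
  obtains \<sigma> where "\<tau> = insert v \<sigma>" "\<sigma> \<in> Poly_Mapping.keys c" "v \<notin> \<sigma>"
proof -
  obtain \<sigma> where "\<sigma> \<in> Poly_Mapping.keys c" "\<tau> \<in> Poly_Mapping.keys
      (if v \<in> \<sigma> then 0 else frag_cmul (vsign v \<sigma>) (frag_of (insert v \<sigma>)))"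
    using subsetD[OF keys_frag_extend assms[unfolded wedge_def]] by blast
  then show thesis
    using that by (auto split: if_splits)
qed

lemma keys_slice:
  assumes "\<tau> \<in> Poly_Mapping.keys (slice v c)"
  obtains \<sigma> where "\<tau> = \<sigma> - {v}" "\<sigma> \<in> Poly_Mapping.keys c" "v \<in> \<sigma>"
proof -
  obtain \<sigma> where "\<sigma> \<in> Poly_Mapping.keys c" "\<tau> \<in> Poly_Mapping.keys
      (if v \<in> \<sigma> then frag_cmul (vsign v \<sigma>) (frag_of (\<sigma> - {v})) else 0)"
    using subsetD[OF keys_frag_extend assms[unfolded slice_def]] by blast
  then show thesis
    using that by (auto split: if_splits)
qed

lemma keys_bd:
  assumes "\<tau> \<in> Poly_Mapping.keys (bd c)"
  obtains \<sigma> v where "\<tau> = \<sigma> - {v}" "\<sigma> \<in> Poly_Mapping.keys c" "v \<in> \<sigma>"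
proof -
  obtain \<sigma> where \<sigma>: "\<sigma> \<in> Poly_Mapping.keys c"
    "\<tau> \<in> Poly_Mapping.keys (\<Sum>v\<in>\<sigma>. frag_cmul (vsign v \<sigma>) (frag_of (\<sigma> - {v})))"
    using subsetD[OF keys_frag_extend assms[unfolded simplicial_boundary_def]]
    unfolding vsign_def by blast
  obtain v where "v \<in> \<sigma>" "\<tau> \<in> Poly_Mapping.keys (frag_cmul (vsign v \<sigma>) (frag_of (\<sigma> - {v})))"
    using subsetD[OF keys_sum \<sigma>(2)] by blast
  then show thesis
    using that \<sigma>(1) by auto
qed

lemma finite_cells_wedge: "finite_cells c \<Longrightarrow> finite_cells (wedge v c)"
  unfolding finite_cells_def by (metis finite_insert keys_wedge)

lemma finite_cells_slice: "finite_cells c \<Longrightarrow> finite_cells (slice v c)"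
  unfolding finite_cells_def by (metis finite_Diff keys_slice)

lemma finite_cells_bd: "finite_cells c \<Longrightarrow> finite_cells (bd c)"
  unfolding finite_cells_def by (metis finite_Diff keys_bd)

lemma finite_cells_of: "finite \<sigma> \<Longrightarrow> finite_cells (frag_of \<sigma>)"
  by (simp add: finite_cells_def)

lemma frag_of_insert:
  assumes "u \<notin> \<tau>"
  shows "frag_of (insert u \<tau>) = frag_cmul (vsign u \<tau>) (wedge u (frag_of \<tau>))"
  using assms by (simp add: wedge_of)

lemma bd_cmul: "bd (frag_cmul n x) = frag_cmul n (bd x)"
  by (simp add: simplicial_boundary_def frag_extend_cmul)

text \<open>
  Both this and the next identity follow by adding the vertices of a cell one at a time, since
  \<open>bd_wedge\<close> and the rules for \<open>slice\<close> and \<open>wedge\<close> determine the operators on a cone.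
\<close>

lemma bd_bd:
  assumes "finite_cells c"
  shows "bd (bd c) = 0"
  using assms
proof (induction rule: finite_cells_induct)
  case (of \<sigma>)
  then show ?case
  proof (induction rule: finite_induct)
    case empty
    show ?case by (simp add: bd_of bd_linear)
  next
    case (insert u \<tau>)
    have "bd (bd (wedge u (frag_of \<tau>))) = wedge u (bd (bd (frag_of \<tau>)))"
      using insert.hyps
      by (simp add: bd_wedge bd_linear finite_cells_of finite_cells_bd)
    then show ?case
      using insert by (simp add: frag_of_insert bd_cmul wedge_linear)
  qed
qed (simp_all add: bd_linear)

lemma slice_bd:
  assumes "finite_cells c"
  shows "slice v (bd c) = - bd (slice v c)"
  using assms
proof (induction rule: finite_cells_induct)
  case (of \<sigma>)
  then show ?case
  proof (induction rule: finite_induct)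
    case empty
    show ?case by (simp add: bd_of slice_of bd_linear slice_linear)
  next
    case (insert u \<tau>)
    note fin = finite_cells_of[OF insert.hyps(1)]
    have "slice v (bd (wedge u (frag_of \<tau>))) = - bd (slice v (wedge u (frag_of \<tau>)))"
    proof (cases "u = v")
      case True
      then show ?thesis
        using insert.IH
        by (simp add: bd_wedge slice_wedge_self fin finite_cells_bd finite_cells_slice
            bd_linear slice_linear wedge_linear)
    next
      case False
      then show ?thesis
        using insert.IH
        by (simp add: bd_wedge slice_wedge fin finite_cells_bd finite_cells_slice
            bd_linear slice_linear wedge_linear)
    qed
    then show ?case
      using insert.hyps by (simp add: frag_of_insert bd_cmul slice_linear frag_cmul_neg)
  qed
qed (simp_all add: bd_linear slice_linear)

section \<open>Chessboard complexes on arbitrary rows and columns\<close>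

definition nonattacking :: "(nat \<times> nat) set \<Rightarrow> bool" where
  "nonattacking \<sigma> \<longleftrightarrow> pairwise (\<lambda>(i, j) (k, l). i \<noteq> k \<and> j \<noteq> l) \<sigma>"

text \<open>
  The inductions remove rows and columns, so the board is a product of two arbitrary sets. The
  parameter \<open>r\<close> is the number of rooks, one more than the dimension.
\<close>

definition rook_faces :: "nat set \<Rightarrow> nat set \<Rightarrow> nat \<Rightarrow> (nat \<times> nat) set set" where
  "rook_faces S C r = {\<sigma>. \<sigma> \<subseteq> S \<times> C \<and> nonattacking \<sigma> \<and> finite \<sigma> \<and> card \<sigma> = r}"

definition rook_chains :: "nat set \<Rightarrow> nat set \<Rightarrow> nat \<Rightarrow> chain set" where
  "rook_chains S C r = {c. Poly_Mapping.keys c \<subseteq> rook_faces S C r}"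

definition rook_cycles :: "nat set \<Rightarrow> nat set \<Rightarrow> nat \<Rightarrow> chain set" where
  "rook_cycles S C r = {c \<in> rook_chains S C r. bd c = 0}"

lemma nonattacking_insert:
  "(i, j) \<notin> \<sigma> \<Longrightarrow> nonattacking (insert (i, j) \<sigma>) \<longleftrightarrow> nonattacking \<sigma> \<and> i \<notin> fst ` \<sigma> \<and> j \<notin> snd ` \<sigma>"
  unfolding nonattacking_def pairwise_insert
  by (auto simp: image_iff split_beta) (metis fst_conv snd_conv prod.collapse)+

lemma nonattacking_mono: "nonattacking \<sigma> \<Longrightarrow> \<tau> \<subseteq> \<sigma> \<Longrightarrow> nonattacking \<tau>"
  unfolding nonattacking_def by (rule pairwise_subset)

lemma nonattackingD:
  "nonattacking \<sigma> \<Longrightarrow> (i, j) \<in> \<sigma> \<Longrightarrow> (i, l) \<in> \<sigma> \<Longrightarrow> j = l"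
  "nonattacking \<sigma> \<Longrightarrow> (i, j) \<in> \<sigma> \<Longrightarrow> (k, j) \<in> \<sigma> \<Longrightarrow> i = k"
  unfolding nonattacking_def pairwise_def by fastforce+

lemma rook_chains_closed:
  "0 \<in> rook_chains S C r"
  "x \<in> rook_chains S C r \<Longrightarrow> y \<in> rook_chains S C r \<Longrightarrow> x + y \<in> rook_chains S C r"
  "x \<in> rook_chains S C r \<Longrightarrow> y \<in> rook_chains S C r \<Longrightarrow> x - y \<in> rook_chains S C r"
  "x \<in> rook_chains S C r \<Longrightarrow> - x \<in> rook_chains S C r"
  using keys_add[of x y] keys_diff[of x y] by (auto simp: rook_chains_def)

lemma rook_chains_sum:
  "(\<And>i. i \<in> I \<Longrightarrow> f i \<in> rook_chains S C r) \<Longrightarrow> sum f I \<in> rook_chains S C r"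
  by (induction I rule: infinite_finite_induct) (auto intro: rook_chains_closed)

lemma rook_chains_finite_cells: "c \<in> rook_chains S C r \<Longrightarrow> finite_cells c"
  by (auto simp: rook_chains_def rook_faces_def finite_cells_def)

lemma rook_chains_mono:
  "c \<in> rook_chains S C r \<Longrightarrow> S \<subseteq> S' \<Longrightarrow> C \<subseteq> C' \<Longrightarrow> c \<in> rook_chains S' C' r"
  unfolding rook_chains_def rook_faces_def by blast

lemma wedge_rook_chains:
  assumes "c \<in> rook_chains (S - {i}) (C - {j}) r" "i \<in> S" "j \<in> C"
  shows "wedge (i, j) c \<in> rook_chains S C (Suc r)"
proof -
  have "insert (i, j) \<sigma> \<in> rook_faces S C (Suc r)" if "\<sigma> \<in> Poly_Mapping.keys c" for \<sigma>
  proof -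
    have "\<sigma> \<in> rook_faces (S - {i}) (C - {j}) r"
      using that assms(1) by (auto simp: rook_chains_def)
    moreover from this have "(i, j) \<notin> \<sigma>" "i \<notin> fst ` \<sigma>" "j \<notin> snd ` \<sigma>"
      by (auto simp: rook_faces_def)
    ultimately show ?thesis
      using assms(2,3) by (auto simp: rook_faces_def nonattacking_insert)
  qed
  then show ?thesis
    unfolding rook_chains_def by (auto elim!: keys_wedge)
qed

lemma slice_rook_chains:
  assumes "c \<in> rook_chains S C (Suc r)"
  shows "slice (i, j) c \<in> rook_chains (S - {i}) (C - {j}) r"
proof -
  have "\<sigma> - {(i, j)} \<in> rook_faces (S - {i}) (C - {j}) r"
    if "\<sigma> \<in> Poly_Mapping.keys c" "(i, j) \<in> \<sigma>" for \<sigma>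
  proof -
    have "\<sigma> \<in> rook_faces S C (Suc r)"
      using that assms(1) by (auto simp: rook_chains_def)
    then show ?thesis
      using that(2) nonattacking_mono[of \<sigma> "\<sigma> - {(i, j)}"] nonattackingD[of \<sigma>]
      by (auto simp: rook_faces_def)
  qed
  then show ?thesis
    unfolding rook_chains_def by (auto elim!: keys_slice)
qed

lemma bd_rook_chains:
  assumes "c \<in> rook_chains S C (Suc r)"
  shows "bd c \<in> rook_chains S C r"
proof -
  have "\<sigma> - {v} \<in> rook_faces S C r" if "\<sigma> \<in> Poly_Mapping.keys c" "v \<in> \<sigma>" for \<sigma> v
  proof -
    have "\<sigma> \<in> rook_faces S C (Suc r)"
      using that assms(1) by (auto simp: rook_chains_def)
    then show ?thesis
      using that(2) nonattacking_mono[of \<sigma> "\<sigma> - {v}"] by (auto simp: rook_faces_def)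
  qed
  then show ?thesis
    unfolding rook_chains_def by (auto elim!: keys_bd)
qed

lemma slice_off_board:
  assumes "c \<in> rook_chains S C r" "i \<notin> S \<or> j \<notin> C"
  shows "slice (i, j) c = 0"
  using assms by (auto simp: slice_eq_0_iff rook_chains_def rook_faces_def)

lemma rook_chains_delete_row:
  assumes "c \<in> rook_chains S C r" "\<And>j. j \<in> C \<Longrightarrow> slice (i, j) c = 0"
  shows "c \<in> rook_chains (S - {i}) C r"
  using assms unfolding rook_chains_def rook_faces_def slice_eq_0_iff by fastforce

lemma rook_chains_delete_column:
  assumes "c \<in> rook_chains S C r" "\<And>i. i \<in> S \<Longrightarrow> slice (i, j) c = 0"
  shows "c \<in> rook_chains S (C - {j}) r"
  using assms unfolding rook_chains_def rook_faces_def slice_eq_0_iff by fastforce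

lemma rook_cyclesD: "c \<in> rook_cycles S C r \<Longrightarrow> c \<in> rook_chains S C r" "c \<in> rook_cycles S C r \<Longrightarrow> bd c = 0"
  by (auto simp: rook_cycles_def)

lemma rook_cycles_closed:
  "0 \<in> rook_cycles S C r"
  "x \<in> rook_cycles S C r \<Longrightarrow> y \<in> rook_cycles S C r \<Longrightarrow> x + y \<in> rook_cycles S C r"
  "x \<in> rook_cycles S C r \<Longrightarrow> y \<in> rook_cycles S C r \<Longrightarrow> x - y \<in> rook_cycles S C r"
  "x \<in> rook_cycles S C r \<Longrightarrow> - x \<in> rook_cycles S C r"
  by (auto simp: rook_cycles_def bd_linear rook_chains_closed)

lemma rook_cycles_sum:
  "(\<And>i. i \<in> I \<Longrightarrow> f i \<in> rook_cycles S C r) \<Longrightarrow> sum f I \<in> rook_cycles S C r"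
  by (induction I rule: infinite_finite_induct) (auto intro: rook_cycles_closed)

lemma rook_cycles_mono:
  "c \<in> rook_cycles S C r \<Longrightarrow> S \<subseteq> S' \<Longrightarrow> C \<subseteq> C' \<Longrightarrow> c \<in> rook_cycles S' C' r"
  using rook_chains_mono by (auto simp: rook_cycles_def)

text \<open>
  Since contraction anticommutes with the boundary, the link of a vertex in a cycle is a cycle on
  the board without the row and column of that vertex.
\<close>

lemma slice_rook_cycles:
  assumes "c \<in> rook_cycles S C (Suc r)"
  shows "slice (i, j) c \<in> rook_cycles (S - {i}) (C - {j}) r"
  using assms slice_rook_chains[of c S C r] slice_bd[of c "(i, j)"] rook_chains_finite_cells[of c]
  by (auto simp: rook_cycles_def slice_linear)

lemma bd_rook_cycles:
  assumes "c \<in> rook_chains S C (Suc r)"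
  shows "bd c \<in> rook_cycles S C r"
  using assms bd_rook_chains bd_bd rook_chains_finite_cells by (auto simp: rook_cycles_def)

section \<open>Acyclicity below the top dimension\<close>

lemma wedge_rook_chains_sum:
  assumes "V \<subseteq> S \<times> C" "\<And>v. v \<in> V \<Longrightarrow> w v \<in> rook_chains (S - {fst v}) (C - {snd v}) r"
  shows "(\<Sum>v\<in>V. wedge v (w v)) \<in> rook_chains S C (Suc r)"
proof (rule rook_chains_sum)
  fix v assume "v \<in> V"
  then show "wedge v (w v) \<in> rook_chains S C (Suc r)"
    using assms wedge_rook_chains[of "w v" S "fst v" C "snd v" r] by auto
qed

lemma slice_wedge_sum:
  assumes "finite V" "\<And>v. v \<in> V \<Longrightarrow> finite_cells (w v)" "\<And>v. v \<in> V \<Longrightarrow> slice u (w v) = 0"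
  shows "slice u (\<Sum>v\<in>V. wedge v (w v)) = (if u \<in> V then w u else 0)"
proof -
  have "slice u (wedge v (w v)) = (if u = v then w v else 0)" if "v \<in> V" for v
    using assms(2,3)[OF that] by (auto simp: slice_wedge slice_wedge_self wedge_linear)
  then show ?thesis
    using assms(1) by (simp add: slice_linear)
qed

text \<open>
  If the link of \<open>v\<close> in \<open>z\<close> bounds \<open>w v\<close>, then adding the boundary of the cone over \<open>w v\<close> replaces the
  star of \<open>v\<close> in \<open>z\<close> by \<open>w v\<close>. This can be done for all vertices of a set simultaneously if the
  fillings avoid the set, which is automatic when the set lies in one row or one column.
\<close>

lemma eliminate_vertices:
  assumes z: "z \<in> rook_cycles S C (Suc r)" and V: "finite V" "V \<subseteq> S \<times> C"
    and w: "\<And>v. v \<in> V \<Longrightarrow> w v \<in> rook_chains (S - {fst v}) (C - {snd v}) (Suc r)"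
    and bd: "\<And>v. v \<in> V \<Longrightarrow> bd (w v) = slice v z"
    and indep: "\<And>u v. u \<in> V \<Longrightarrow> v \<in> V \<Longrightarrow> slice u (w v) = 0"
  defines "y \<equiv> \<Sum>v\<in>V. wedge v (w v)"
  shows "y \<in> rook_chains S C (Suc (Suc r))" "z + bd y \<in> rook_cycles S C (Suc r)"
    "\<And>u. u \<in> V \<Longrightarrow> slice u (z + bd y) = 0"
    "\<And>u. slice u z = 0 \<Longrightarrow> (\<And>v. v \<in> V \<Longrightarrow> slice u (w v) = 0) \<Longrightarrow> slice u (z + bd y) = 0"
proof -
  show y: "y \<in> rook_chains S C (Suc (Suc r))"
    unfolding y_def using V w by (intro wedge_rook_chains_sum) auto
  show "z + bd y \<in> rook_cycles S C (Suc r)"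
    using z bd_rook_cycles[OF y] by (rule rook_cycles_closed)
  have fin: "finite_cells (w v)" if "v \<in> V" for v
    using w[OF that] rook_chains_finite_cells by blast
  have *: "slice u (z + bd y) = slice u z - (if u \<in> V then bd (w u) else 0)"
    if "\<And>v. v \<in> V \<Longrightarrow> slice u (w v) = 0" for u
    using slice_bd[OF rook_chains_finite_cells[OF y], of u] slice_wedge_sum[OF V(1) fin that]
    by (simp add: slice_linear y_def bd_linear)
  show "slice u (z + bd y) = 0" if "u \<in> V" for u
    using that * indep bd by simp
  show "slice u (z + bd y) = 0"
    if "slice u z = 0" "\<And>v. v \<in> V \<Longrightarrow> slice u (w v) = 0" for u
    using that *[of u] bd[of u] by (auto simp: bd_linear)
qed

text \<open>
  The cells of such a cycle use neither the row nor the column of \<open>(s, c)\<close>, except through this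
  vertex. So the whole cycle can be coned off.
\<close>

lemma cycle_bounds_in_star:
  assumes z: "z \<in> rook_cycles S C r" and "s \<in> S" "c \<in> C"
    and row: "\<And>j. j \<in> C - {c} \<Longrightarrow> slice (s, j) z = 0"
    and col: "\<And>i. i \<in> S - {s} \<Longrightarrow> slice (i, c) z = 0"
  shows "wedge (s, c) z \<in> rook_chains S C (Suc r)" "bd (wedge (s, c) z) = z"
proof -
  have "insert (s, c) \<sigma> \<in> rook_faces S C (Suc r)"
    if \<sigma>z: "\<sigma> \<in> Poly_Mapping.keys z" "(s, c) \<notin> \<sigma>" for \<sigma>
  proof -
    have \<sigma>: "\<sigma> \<in> rook_faces S C r"
      using \<sigma>z(1) rook_cyclesD(1)[OF z] by (auto simp: rook_chains_def)
    have "(s, j) \<notin> \<sigma>" if "j \<in> C" for j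
      using row[of j] that \<sigma>z by (cases "j = c") (auto simp: slice_eq_0_iff)
    moreover have "(i, c) \<notin> \<sigma>" if "i \<in> S" for i
      using col[of i] that \<sigma>z by (cases "i = s") (auto simp: slice_eq_0_iff)
    ultimately have "s \<notin> fst ` \<sigma>" "c \<notin> snd ` \<sigma>"
      using \<sigma> by (auto simp: rook_faces_def)
    then show ?thesis
      using \<sigma> \<sigma>z(2) \<open>s \<in> S\<close> \<open>c \<in> C\<close> by (auto simp: rook_faces_def nonattacking_insert)
  qed
  then show "wedge (s, c) z \<in> rook_chains S C (Suc r)"
    unfolding rook_chains_def by (auto elim!: keys_wedge)
  show "bd (wedge (s, c) z) = z"
    using z bd_wedge[of z] rook_chains_finite_cells
    by (auto simp: rook_cycles_def wedge_linear)
qed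

text \<open>
  By induction on the rows. Fix a row \<open>s\<close> and a column \<open>c\<close>. Links of the vertices \<open>(i, c)\<close> with
  \<open>i \<noteq> s\<close> live on a board with one row and one column less, hence bound; this clears the column.
  Then the links of the vertices \<open>(s, j)\<close> with \<open>j \<noteq> c\<close> avoid the column \<open>c\<close> too. They live on a board
  with one row and two columns less, which is what the hypothesis on the sizes allows, and
  this clears the row. What is left lies in the star of \<open>(s, c)\<close>.
\<close>

theorem rook_cycles_bound:
  assumes "finite S" "r < card S" "2 * card S \<le> card C + 1" "z \<in> rook_cycles S C r"
  shows "\<exists>y \<in> rook_chains S C (Suc r). bd y = z"
  using assms
proof (induction "card S" arbitrary: S C r z)
  case 0
  then show ?case by simp
next
  case (Suc n)
  note z = \<open>z \<in> rook_cycles S C r\<close>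
  have finC: "finite C" "C \<noteq> {}"
    using Suc.prems Suc.hyps(2) by (auto intro: card_ge_0_finite)
  obtain s c where s: "s \<in> S" and c: "c \<in> C"
    using Suc.hyps(2) finC by (metis card.empty equals0I nat.distinct(1))
  show ?case
  proof (cases r)
    case 0
    have "slice v z = 0" for v
      using z 0 by (auto simp: slice_eq_0_iff rook_cycles_def rook_chains_def rook_faces_def)
    then show ?thesis
      using cycle_bounds_in_star[OF z s c] by blast
  next
    case (Suc r')
    have z': "z \<in> rook_cycles S C (Suc r')"
      using z Suc by simp
    have cardS: "card (S - {i}) = n" if "i \<in> S" for i
      using that Suc.hyps(2) Suc.prems(1) by simp
    have "\<exists>w \<in> rook_chains (S - {i}) (C - {c}) (Suc r'). bd w = slice (i, c) z" if "i \<in> S" for i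
      using that cardS[OF that] Suc.prems \<open>r = Suc r'\<close> Suc.hyps(2) c finC(1)
      by (intro Suc.hyps(1) slice_rook_cycles[OF z']) auto
    then obtain w where w: "\<And>i. i \<in> S \<Longrightarrow> w i \<in> rook_chains (S - {i}) (C - {c}) (Suc r')"
      "\<And>i. i \<in> S \<Longrightarrow> bd (w i) = slice (i, c) z"
      by metis
    \<comment> \<open>Clear the column \<open>c\<close> outside the row \<open>s\<close>.\<close>
    define V where "V = (\<lambda>i. (i, c)) ` (S - {s})"
    define y where "y = (\<Sum>v\<in>V. wedge v (w (fst v)))"
    define z1 where "z1 = z + bd y"
    have V: "finite V" "V \<subseteq> S \<times> C"
      using Suc.prems(1) c by (auto simp: V_def)
    have offV: "slice (i, c) (w k) = 0" if "k \<in> S" for i k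
      using w(1)[OF that] by (intro slice_off_board[of _ "S - {k}" "C - {c}"]) auto
    have "\<And>v. v \<in> V \<Longrightarrow> w (fst v) \<in> rook_chains (S - {fst v}) (C - {snd v}) (Suc r')"
      "\<And>v. v \<in> V \<Longrightarrow> bd (w (fst v)) = slice v z"
      "\<And>u v. u \<in> V \<Longrightarrow> v \<in> V \<Longrightarrow> slice u (w (fst v)) = 0"
      using w offV by (auto simp: V_def)
    note elim = eliminate_vertices[OF z' V this, folded y_def z1_def]
    have y: "y \<in> rook_chains S C (Suc r)" and z1: "z1 \<in> rook_cycles S C (Suc r')"
      and z1_col: "\<And>i. i \<in> S - {s} \<Longrightarrow> slice (i, c) z1 = 0"
      using elim(1-3) \<open>r = Suc r'\<close> by (auto simp: V_def)
    have "\<exists>x \<in> rook_chains (S - {s}) (C - {c} - {j}) (Suc r'). bd x = slice (s, j) z1"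
      if j: "j \<in> C - {c}" for j
    proof -
      have "slice (i, c) (slice (s, j) z1) = 0" if "i \<in> S - {s}" for i
        using z1_col[OF that] unfolding slice_eq_0_iff by (blast elim!: keys_slice)
      then have "slice (s, j) z1 \<in> rook_chains (S - {s}) (C - {j} - {c}) r'"
        by (rule rook_chains_delete_column[OF rook_cyclesD(1)[OF slice_rook_cycles[OF z1]]])
      moreover have "C - {j} - {c} = C - {c} - {j}"
        by auto
      ultimately have "slice (s, j) z1 \<in> rook_cycles (S - {s}) (C - {c} - {j}) r'"
        using rook_cyclesD(2)[OF slice_rook_cycles[OF z1, of s j]] by (simp add: rook_cycles_def)
      then show ?thesis
        using j cardS[OF s] Suc.prems \<open>r = Suc r'\<close> Suc.hyps(2) c s finC(1)
        by (intro Suc.hyps(1)) auto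
    qed
    then obtain x where x: "\<And>j. j \<in> C - {c} \<Longrightarrow> x j \<in> rook_chains (S - {s}) (C - {c} - {j}) (Suc r')"
      "\<And>j. j \<in> C - {c} \<Longrightarrow> bd (x j) = slice (s, j) z1"
      by metis
    \<comment> \<open>Clear the row \<open>s\<close>. The fillings avoid the column \<open>c\<close>, so that
      nothing returns to it.\<close>
    define W where "W = (\<lambda>j. (s, j)) ` (C - {c})"
    define y' where "y' = (\<Sum>v\<in>W. wedge v (x (snd v)))"
    define z2 where "z2 = z1 + bd y'"
    have W: "finite W" "W \<subseteq> S \<times> C"
      using finC s by (auto simp: W_def)
    have offW: "slice (s, j) (x k) = 0" if "k \<in> C - {c}" for j k
      using x(1)[OF that] by (intro slice_off_board[of _ "S - {s}" "C - {c} - {k}"]) auto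
    have offc: "slice (i, c) (x k) = 0" if "k \<in> C - {c}" for i k
      using x(1)[OF that] by (intro slice_off_board[of _ "S - {s}" "C - {c} - {k}"]) auto
    have x_big: "x k \<in> rook_chains (S - {s}) (C - {k}) (Suc r')" if "k \<in> C - {c}" for k
      using x(1)[OF that] by (rule rook_chains_mono) auto
    have "\<And>v. v \<in> W \<Longrightarrow> x (snd v) \<in> rook_chains (S - {fst v}) (C - {snd v}) (Suc r')"
      "\<And>v. v \<in> W \<Longrightarrow> bd (x (snd v)) = slice v z1"
      "\<And>u v. u \<in> W \<Longrightarrow> v \<in> W \<Longrightarrow> slice u (x (snd v)) = 0"
      using x(2) x_big offW unfolding W_def by (fastforce simp del: Diff_iff)+
    note elim' = eliminate_vertices[OF z1 W this, folded y'_def z2_def]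
    have y': "y' \<in> rook_chains S C (Suc r)" and z2: "z2 \<in> rook_cycles S C r"
      and z2_row: "\<And>j. j \<in> C - {c} \<Longrightarrow> slice (s, j) z2 = 0"
      using elim'(1-3) \<open>r = Suc r'\<close> by (auto simp: W_def)
    have z2_col: "slice (i, c) z2 = 0" if "i \<in> S - {s}" for i
    proof -
      have "slice (i, c) (x (snd v)) = 0" if "v \<in> W" for v
        using that offc unfolding W_def by (metis (no_types, lifting) imageE snd_conv)
      then show ?thesis
        using elim'(4) z1_col[OF that] by blast
    qed
    have "wedge (s, c) z2 \<in> rook_chains S C (Suc r)" "bd (wedge (s, c) z2) = z2"
      using cycle_bounds_in_star[OF z2 s c z2_row z2_col] by auto
    then show ?thesis
      using y y' by (intro bexI[of _ "wedge (s, c) z2 - y' - y"])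
        (auto simp: bd_linear z2_def z1_def intro: rook_chains_closed)
  qed
qed


section \<open>Top-dimensional cycles are spanned by suspensions\<close>

lemma rook_face_rows:
  assumes "finite S" "\<sigma> \<in> rook_faces S C (card S)"
  shows "fst ` \<sigma> = S"
proof -
  have "inj_on fst \<sigma>"
    using assms(2) nonattackingD(1)[of \<sigma>] by (auto simp: inj_on_def rook_faces_def)
  then have "card (fst ` \<sigma>) = card S"
    using assms(2) by (simp add: card_image rook_faces_def)
  then show ?thesis
    using assms by (intro card_subset_eq) (auto simp: rook_faces_def)
qed

lemma top_chain_expand:
  assumes "finite S" "finite C" "s \<in> S" "x \<in> rook_chains S C (card S)"
  shows "x = (\<Sum>j\<in>C. wedge (s, j) (slice (s, j) x))"
proof (rule poly_mapping_eqI)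
  fix \<sigma>
  show "Poly_Mapping.lookup x \<sigma> = Poly_Mapping.lookup (\<Sum>j\<in>C. wedge (s, j) (slice (s, j) x)) \<sigma>"
  proof (cases "\<sigma> \<in> Poly_Mapping.keys x")
    case True
    then have \<sigma>: "\<sigma> \<in> rook_faces S C (card S)"
      using assms(4) by (auto simp: rook_chains_def)
    then obtain j where j: "(s, j) \<in> \<sigma>" "j \<in> C"
      using rook_face_rows[OF assms(1) \<sigma>] assms(3) by (fastforce simp: rook_faces_def)
    have "(s, k) \<in> \<sigma> \<longleftrightarrow> k = j" for k
      using j nonattackingD(1) \<sigma> by (fastforce simp: rook_faces_def)
    then show ?thesis
      using assms(2) j by (simp add: lookup_sum wedge_slice_lookup)
  next
    case False
    then show ?thesis
      by (simp add: lookup_sum wedge_slice_lookup in_keys_iff cong: if_cong)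
  qed
qed

text \<open>
  On the board with an additional row \<open>t\<close> the cycle is no longer top-dimensional, so it bounds some
  \<open>x\<close>. Every cell of \<open>x\<close> uses the row \<open>t\<close> exactly once, and its part through \<open>(t, j)\<close> is the cone over
  a cycle that misses the column \<open>j\<close>.
\<close>

lemma top_cycle_split:
  assumes "finite S" "2 * card S + 1 \<le> card C" "z \<in> rook_cycles S C (card S)"
  obtains y where "\<And>j. j \<in> C \<Longrightarrow> y j \<in> rook_cycles S (C - {j}) (card S)" "z = (\<Sum>j\<in>C. y j)"
proof -
  obtain t where t: "t \<notin> S"
    using assms(1) ex_new_if_finite infinite_UNIV_nat by blast
  have finC: "finite C"
    using assms(2) by (auto intro: card_ge_0_finite)
  have "z \<in> rook_cycles (insert t S) C (card S)"
    using assms(3) by (rule rook_cycles_mono) auto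
  then obtain x where x: "x \<in> rook_chains (insert t S) C (Suc (card S))" "bd x = z"
    using rook_cycles_bound[of "insert t S" "card S" C z] assms(1,2) t by auto
  define y where "y j = slice (t, j) x" for j
  note fin = rook_chains_finite_cells[OF x(1)]
  have "slice (t, j) z = 0" for j
    using rook_cyclesD(1)[OF assms(3)] t by (intro slice_off_board) auto
  then have bd_y: "bd (y j) = 0" for j
    using slice_bd[OF fin, of "(t, j)"] x(2) by (simp add: y_def)
  have y: "y j \<in> rook_cycles S (C - {j}) (card S)" for j
    using slice_rook_chains[OF x(1), of t j] t bd_y by (simp add: rook_cycles_def y_def)
  have "x = (\<Sum>j\<in>C. wedge (t, j) (y j))"
    unfolding y_def using x(1) assms(1) t finC by (intro top_chain_expand[of "insert t S"]) auto
  then have "z = bd (\<Sum>j\<in>C. wedge (t, j) (y j))"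
    using x(2) by simp
  also have "\<dots> = (\<Sum>j\<in>C. bd (wedge (t, j) (y j)))"
    using finC by (simp add: bd_linear)
  also have "\<dots> = (\<Sum>j\<in>C. y j)"
    using bd_y finite_cells_slice[OF fin]
    by (intro sum.cong) (simp_all add: bd_wedge wedge_linear y_def)
  finally show ?thesis
    using that y by blast
qed

text \<open>
  The suspension of \<open>w\<close> with the two suspension points \<open>(i, a)\<close> and \<open>(i, b)\<close>.
\<close>

definition susp :: "nat \<Rightarrow> nat \<Rightarrow> nat \<Rightarrow> chain \<Rightarrow> chain" where
  "susp i a b w = wedge (i, b) w - wedge (i, a) w"

lemma susp_linear:
  "susp i a b 0 = 0" "susp i a b (x + y) = susp i a b x + susp i a b y"
  "susp i a b (x - y) = susp i a b x - susp i a b y" "susp i a b (- x) = - susp i a b x"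
  by (simp_all add: susp_def wedge_linear)

lemma susp_rook_cycles:
  assumes "w \<in> rook_cycles (S - {i}) (C - {a, b}) r" "i \<in> S" "a \<in> C" "b \<in> C"
  shows "susp i a b w \<in> rook_cycles S C (Suc r)"
proof -
  have "wedge (i, j) w \<in> rook_chains S C (Suc r)" if "j \<in> {a, b}" for j
    using that assms rook_cyclesD(1)[OF assms(1)]
    by (intro wedge_rook_chains) (auto intro: rook_chains_mono)
  moreover have "bd (wedge (i, j) w) = w" for j
    using bd_wedge rook_chains_finite_cells rook_cyclesD[OF assms(1)] by (simp add: wedge_linear)
  ultimately show ?thesis
    by (simp add: rook_cycles_def susp_def bd_linear rook_chains_closed)
qed

lemma susp_susp:
  "finite_cells w \<Longrightarrow> susp i a b (susp t c d w) = - susp t c d (susp i a b w)"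
  using wedge_wedge[of w "(i, a)"] wedge_wedge[of w "(i, b)"]
  by (simp add: susp_def wedge_linear)

lemma slice_susp:
  assumes "finite_cells w" "slice (i, j) w = 0"
  shows "slice (i, j) (susp t a b w)
    = (if (i, j) = (t, b) then w else 0) - (if (i, j) = (t, a) then w else 0)"
  using assms by (auto simp: susp_def slice_linear slice_wedge slice_wedge_self wedge_linear)

text \<open>
  Fix a column \<open>c\<close>. For \<open>i \<noteq> s\<close> the link of \<open>(i, c)\<close> lives on a board whose columns exceed twice its
  rows by one, so it splits into cycles \<open>y i j\<close> missing a further column \<open>j\<close>, and suspending \<open>y i j\<close> with \<open>(i, j)\<close> and \<open>(i, c)\<close> accounts
  for the star of \<open>(i, c)\<close>. These suspensions have the wrong row \<open>i\<close>, but by induction \<open>y i j\<close> is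
  itself a combination of suspensions in the row \<open>s\<close>, and suspensions anticommute. Once the column
  \<open>c\<close> is cleared, suspending the links of the vertices \<open>(s, j)\<close> with \<open>(s, c)\<close> accounts for the rest: a
  cycle all of whose cells contain \<open>(s, c)\<close> is zero.
\<close>

theorem top_cycles_generated_by_suspensions:
  assumes "finite S" "s \<in> S" "card C = 2 * card S" "z \<in> rook_cycles S C (card S)"
  shows "z \<in> group_closure {susp s a b w |a b w. a \<in> C \<and> b \<in> C \<and> a \<noteq> b \<and>
    w \<in> rook_cycles (S - {s}) (C - {a, b}) (card S - 1)}"
  using assms
proof (induction "card S" arbitrary: S C z)
  case 0
  then show ?case by simp
next
  case (Suc n)
  let ?G = "\<lambda>S C. {susp s a b w |a b w. a \<in> C \<and> b \<in> C \<and> a \<noteq> b \<and>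
    w \<in> rook_cycles (S - {s}) (C - {a, b}) (card S - 1)}"
  have z: "z \<in> rook_cycles S C (Suc n)"
    using Suc.prems Suc.hyps(2) by simp
  have finC: "finite C" "C \<noteq> {}"
    using Suc.prems Suc.hyps(2) by (auto intro: card_ge_0_finite)
  then obtain c where c: "c \<in> C"
    by blast
  have cardS: "card (S - {i}) = n" if "i \<in> S" for i
    using that Suc.hyps(2) Suc.prems(1) by simp
  have "\<exists>y. (\<forall>j\<in>C - {c}. y j \<in> rook_cycles (S - {i}) (C - {c} - {j}) n) \<and>
      slice (i, c) z = (\<Sum>j\<in>C - {c}. y j)" if "i \<in> S" for i
  proof -
    have "slice (i, c) z \<in> rook_cycles (S - {i}) (C - {c}) (card (S - {i}))"
      using slice_rook_cycles[OF z] cardS[OF that] by simp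
    moreover have "2 * card (S - {i}) + 1 \<le> card (C - {c})"
      using Suc.prems(3) Suc.hyps(2) cardS[OF that] c finC by simp
    ultimately show ?thesis
      using top_cycle_split[of "S - {i}" "C - {c}" "slice (i, c) z"] Suc.prems(1) cardS[OF that]
      by (metis finite_Diff)
  qed
  then obtain y where y: "\<And>i j. i \<in> S \<Longrightarrow> j \<in> C - {c} \<Longrightarrow> y i j \<in> rook_cycles (S - {i}) (C - {c} - {j}) n"
    and y_sum: "\<And>i. i \<in> S \<Longrightarrow> slice (i, c) z = (\<Sum>j\<in>C - {c}. y i j)"
    by metis
  have y_fin: "finite_cells (y i j)" and y_c: "slice (k, c) (y i j) = 0"
    if "i \<in> S" "j \<in> C - {c}" for i j k
    using rook_cyclesD(1)[OF y[OF that]] rook_chains_finite_cells slice_off_board by blast+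
  \<comment> \<open>The stars of the vertices of the column \<open>c\<close> outside the row \<open>s\<close>.\<close>
  define A where "A = (\<Sum>i\<in>S - {s}. \<Sum>j\<in>C - {c}. susp i j c (y i j))"
  have A_term: "susp i j c (y i j) \<in> group_closure (?G S C)" if i: "i \<in> S - {s}" and j: "j \<in> C - {c}" for i j
  proof -
    have "y i j \<in> group_closure (?G (S - {i}) (C - {c} - {j}))"
    proof (rule Suc.hyps(1))
      show "card (C - {c} - {j}) = 2 * card (S - {i})"
        using Suc.prems(3) Suc.hyps(2) cardS[of i] i c j finC by simp
    qed (use i j y[of i j] Suc.prems(1,2) cardS[of i] in auto)
    then show ?thesis
    proof (rule group_closure_map)
      fix x assume "x \<in> ?G (S - {i}) (C - {c} - {j})"
      then obtain a b w where x: "x = susp s a b w" and ab: "a \<in> C - {c} - {j}" "b \<in> C - {c} - {j}" "a \<noteq> b"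
        and w: "w \<in> rook_cycles (S - {i} - {s}) (C - {c} - {j} - {a, b}) (card (S - {i}) - 1)"
        by blast
      have "S - {i} - {s} = S - {s} - {i}" "C - {c} - {j} - {a, b} = C - {a, b} - {j, c}"
        by auto
      then have "susp i j c w \<in> rook_cycles (S - {s}) (C - {a, b}) (Suc (card (S - {i}) - 1))"
        using w i j c ab by (intro susp_rook_cycles) auto
      moreover have "Suc (card (S - {i}) - 1) = card S - 1"
      proof -
        have "card (S - {i}) > 0"
          using Suc.prems(1,2) i by (intro card_gt_0_iff[THEN iffD2]) auto
        then show ?thesis
          using cardS[of i] i Suc.hyps(2) by simp
      qed
      ultimately have "susp s a b (susp i j c w) \<in> ?G S C"
        using ab by auto
      moreover have "susp i j c x = - susp s a b (susp i j c w)"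
        unfolding x using w by (intro susp_susp) (blast dest: rook_cyclesD rook_chains_finite_cells)
      ultimately show "susp i j c x \<in> group_closure (?G S C)"
        by (simp add: group_closure.base)
    qed (simp_all add: susp_linear)
  qed
  have A: "A \<in> group_closure (?G S C)"
    unfolding A_def by (intro group_closure_sums A_term)
  have A_cycle: "A \<in> rook_cycles S C (Suc n)"
    unfolding A_def
  proof (intro rook_cycles_sum susp_rook_cycles)
    fix i j assume "i \<in> S - {s}" "j \<in> C - {c}"
    moreover have "C - {c} - {j} = C - {j, c}"
      by auto
    ultimately show "y i j \<in> rook_cycles (S - {i}) (C - {j, c}) n"
      using y[of i j] by simp
  qed (use c in auto)
  define z1 where "z1 = z - A"
  have z1: "z1 \<in> rook_cycles S C (Suc n)"
    using z A_cycle by (simp add: z1_def rook_cycles_closed)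
  have z1_col: "slice (k, c) z1 = 0" if k: "k \<in> S - {s}" for k
  proof -
    have "slice (k, c) A = (\<Sum>i\<in>S - {s}. \<Sum>j\<in>C - {c}. if k = i then y i j else 0)"
      unfolding A_def using Suc.prems(1) finC
      by (auto simp: slice_linear slice_susp y_fin y_c intro!: sum.cong)
    also have "\<dots> = (\<Sum>i\<in>S - {s}. if k = i then \<Sum>j\<in>C - {c}. y i j else 0)"
      by (intro sum.cong) auto
    also have "\<dots> = (\<Sum>j\<in>C - {c}. y k j)"
      using k Suc.prems(1) by simp
    finally show ?thesis
      using k y_sum[of k] by (simp add: z1_def slice_linear)
  qed
  have x: "slice (s, j) z1 \<in> rook_cycles (S - {s}) (C - {c, j}) n" if "j \<in> C - {c}" for j
  proof -
    have "slice (i, c) (slice (s, j) z1) = 0" if "i \<in> S - {s}" for i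
      using z1_col[OF that] unfolding slice_eq_0_iff by (blast elim!: keys_slice)
    then have "slice (s, j) z1 \<in> rook_chains (S - {s}) (C - {j} - {c}) n"
      by (rule rook_chains_delete_column[OF rook_cyclesD(1)[OF slice_rook_cycles[OF z1]]])
    moreover have "C - {j} - {c} = C - {c, j}"
      by auto
    ultimately show ?thesis
      using rook_cyclesD(2)[OF slice_rook_cycles[OF z1, of s j]] by (simp add: rook_cycles_def)
  qed
  \<comment> \<open>The stars of the vertices of the row \<open>s\<close> outside the column \<open>c\<close>.\<close>
  define B where "B = (\<Sum>j\<in>C - {c}. susp s c j (slice (s, j) z1))"
  have B: "B \<in> group_closure (?G S C)"
    unfolding B_def
  proof (intro group_closure_sums group_closure.base insertI2)
    fix j assume j: "j \<in> C - {c}"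
    then have "c \<noteq> j" "j \<in> C" "card S - 1 = n"
      using Suc.hyps(2) by auto
    then show "susp s c j (slice (s, j) z1) \<in> ?G S C"
      using x[OF j] c by blast
  qed
  have B_cycle: "B \<in> rook_cycles S C (Suc n)"
    unfolding B_def using x c Suc.prems(2) by (intro rook_cycles_sum susp_rook_cycles) auto
  define z2 where "z2 = z1 - B"
  have z2: "z2 \<in> rook_cycles S C (Suc n)"
    using z1 B_cycle by (simp add: z2_def rook_cycles_closed)
  have z2_row: "slice (s, k) z2 = 0" if k: "k \<in> C - {c}" for k
  proof -
    have "slice (s, k) (slice (s, j) z1) = 0" for j
      using rook_cyclesD(1)[OF slice_rook_cycles[OF z1, of s j]] by (intro slice_off_board) auto
    moreover have "finite_cells (slice (s, j) z1)" for j
      using finite_cells_slice rook_chains_finite_cells rook_cyclesD(1)[OF z1] by blast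
    ultimately have "slice (s, k) B = (\<Sum>j\<in>C - {c}. if j = k then slice (s, j) z1 else 0)"
      unfolding B_def using finC k by (auto simp: slice_linear slice_susp intro!: sum.cong)
    then show ?thesis
      using k finC by (simp add: z2_def slice_linear)
  qed
  \<comment> \<open>What remains is a cycle in which every cell contains \<open>(s, c)\<close>.\<close>
  define w where "w = slice (s, c) z2"
  have "z2 = (\<Sum>j\<in>C. wedge (s, j) (slice (s, j) z2))"
    using z2 Suc.hyps(2) Suc.prems(1,2) finC by (intro top_chain_expand) (auto dest: rook_cyclesD)
  also have "\<dots> = (\<Sum>j\<in>C. if j = c then wedge (s, c) w else 0)"
    using z2_row by (intro sum.cong) (auto simp: w_def wedge_linear)
  finally have z2_eq: "z2 = wedge (s, c) w"
    using c finC by simp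
  have "bd w = 0"
    unfolding w_def by (rule rook_cyclesD(2)[OF slice_rook_cycles[OF z2]])
  moreover have "finite_cells w"
    unfolding w_def using finite_cells_slice rook_chains_finite_cells rook_cyclesD(1)[OF z2] by blast
  ultimately have "bd z2 = w"
    unfolding z2_eq by (simp add: bd_wedge wedge_linear)
  then have "z2 = 0"
    using rook_cyclesD(2)[OF z2] z2_eq by (simp add: wedge_linear)
  then have "z = A + B"
    by (simp add: z2_def z1_def algebra_simps)
  then show ?case
    using A B by (simp add: group_closure_add)
qed

section \<open>Cross-polytopal spheres\<close>

fun cols :: "(nat \<times> nat) list \<Rightarrow> nat list" where
  "cols [] = []"
| "cols ((a, b) # ps) = a # b # cols ps"

text \<open>
  The pairs of columns are used in the consecutive rows \<open>s\<close>, \<open>Suc s\<close> and so on; starting from the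
  empty cell, the result is the fundamental cycle of the boundary of a cross-polytope.
\<close>

fun multi_susp :: "nat \<Rightarrow> (nat \<times> nat) list \<Rightarrow> chain \<Rightarrow> chain" where
  "multi_susp s [] w = w"
| "multi_susp s ((a, b) # ps) w = susp s a b (multi_susp (Suc s) ps w)"

abbreviation cross_sphere :: "nat \<Rightarrow> (nat \<times> nat) list \<Rightarrow> chain" where
  "cross_sphere s ps \<equiv> multi_susp s ps (frag_of {})"

lemma cols_append [simp]: "cols (ps @ qs) = cols ps @ cols qs"
  by (induction ps rule: cols.induct) auto

lemma set_cols: "set (cols ps) = fst ` set ps \<union> snd ` set ps"
  by (induction ps rule: cols.induct) auto

lemma distinct_cols_iff:
  "distinct (cols ps) \<longleftrightarrow> distinct (map fst ps) \<and> distinct (map snd ps) \<and> fst ` set ps \<inter> snd ` set ps = {}"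
  by (induction ps rule: cols.induct) (auto simp: set_cols)

lemma multi_susp_append:
  "multi_susp s (ps @ qs) w = multi_susp s ps (multi_susp (s + length ps) qs w)"
  by (induction s ps w rule: multi_susp.induct) auto

lemma multi_susp_linear:
  "multi_susp s ps 0 = 0"
  "multi_susp s ps (x + y) = multi_susp s ps x + multi_susp s ps y"
  "multi_susp s ps (x - y) = multi_susp s ps x - multi_susp s ps y"
  "multi_susp s ps (- x) = - multi_susp s ps x"
  by (induction s ps x rule: multi_susp.induct) (auto simp: susp_linear)

lemma multi_susp_rook_cycles:
  assumes "w \<in> rook_cycles {s + length ps..<s + length ps + r} C r"
    "distinct (cols ps)" "set (cols ps) \<inter> C = {}"
  shows "multi_susp s ps w \<in> rook_cycles {s..<s + (length ps + r)} (C \<union> set (cols ps)) (length ps + r)"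
  using assms
proof (induction s ps w rule: multi_susp.induct)
  case (2 s a b ps w)
  have "{s..<s + (length ((a, b) # ps) + r)} - {s} = {Suc s..<Suc s + (length ps + r)}"
    "C \<union> set (cols ((a, b) # ps)) - {a, b} = C \<union> set (cols ps)"
    using 2(3,4) by auto
  then have "multi_susp (Suc s) ps w \<in> rook_cycles ({s..<s + (length ((a, b) # ps) + r)} - {s})
      (C \<union> set (cols ((a, b) # ps)) - {a, b}) (length ps + r)"
    using 2 by simp
  from susp_rook_cycles[OF this] show ?case
    by simp
qed simp

lemma empty_cell_rook_cycle: "frag_of {} \<in> rook_cycles S C 0"
  by (simp add: rook_cycles_def rook_chains_def rook_faces_def nonattacking_def bd_of)

lemma cross_sphere_rook_cycles:
  assumes "distinct (cols ps)"
  shows "cross_sphere s ps \<in> rook_cycles {s..<s + length ps} (set (cols ps)) (length ps)"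
  using multi_susp_rook_cycles[where s = s and C = "{}" and r = 0, OF empty_cell_rook_cycle assms] by simp

theorem top_cycles_generated_by_cross_spheres:
  assumes "finite C" "card C = 2 * k" "z \<in> rook_cycles {s..<s + k} C k"
  shows "z \<in> group_closure {cross_sphere s ps |ps. length ps = k \<and> distinct (cols ps) \<and> set (cols ps) = C}"
  using assms
proof (induction k arbitrary: s C z)
  case 0
  have "z = frag_cmul (Poly_Mapping.lookup z {}) (frag_of {})"
  proof (rule poly_mapping_eqI)
    fix \<sigma>
    show "Poly_Mapping.lookup z \<sigma> = Poly_Mapping.lookup (frag_cmul (Poly_Mapping.lookup z {}) (frag_of {})) \<sigma>"
      using 0 by (cases "\<sigma> = {}")
        (auto simp: rook_cycles_def rook_chains_def rook_faces_def lookup_single when_def in_keys_iff)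
  qed
  moreover have "frag_of {} \<in> {cross_sphere s ps |ps. length ps = 0 \<and> distinct (cols ps) \<and> set (cols ps) = C}"
    using 0 by auto
  ultimately show ?case
    using group_closure_cmul group_closure.base by (metis (no_types, lifting) insertI2)
next
  case (Suc k)
  let ?S = "{s..<s + Suc k}" and ?G = "{cross_sphere s ps |ps. length ps = Suc k \<and> distinct (cols ps) \<and> set (cols ps) = C}"
  have "z \<in> group_closure {susp s a b w |a b w. a \<in> C \<and> b \<in> C \<and> a \<noteq> b \<and>
      w \<in> rook_cycles (?S - {s}) (C - {a, b}) (card ?S - 1)}"
    using Suc.prems by (intro top_cycles_generated_by_suspensions) auto
  then show ?case
  proof (rule group_closure_map[where f = "\<lambda>x. x"])
    fix x assume "x \<in> {susp s a b w |a b w. a \<in> C \<and> b \<in> C \<and> a \<noteq> b \<and>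
      w \<in> rook_cycles (?S - {s}) (C - {a, b}) (card ?S - 1)}"
    then obtain a b w where x: "x = susp s a b w" and ab: "a \<in> C" "b \<in> C" "a \<noteq> b"
      and w: "w \<in> rook_cycles (?S - {s}) (C - {a, b}) (card ?S - 1)"
      by blast
    have "?S - {s} = {Suc s..<Suc s + k}" "card ?S - 1 = k"
      by auto
    then have "w \<in> group_closure {cross_sphere (Suc s) ps |ps. length ps = k \<and> distinct (cols ps) \<and> set (cols ps) = C - {a, b}}"
      using w ab Suc.prems by (intro Suc.IH) (auto simp: card_Diff_subset)
    then show "x \<in> group_closure ?G"
      unfolding x
    proof (rule group_closure_map)
      fix y assume "y \<in> {cross_sphere (Suc s) ps |ps. length ps = k \<and> distinct (cols ps) \<and> set (cols ps) = C - {a, b}}"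
      then obtain ps where "y = cross_sphere (Suc s) ps" "length ps = k" "distinct (cols ps)" "set (cols ps) = C - {a, b}"
        by blast
      then have "susp s a b y = cross_sphere s ((a, b) # ps)" "length ((a, b) # ps) = Suc k"
        "distinct (cols ((a, b) # ps))" "set (cols ((a, b) # ps)) = C"
        using ab by auto
      then show "susp s a b y \<in> group_closure ?G"
        by (intro group_closure.base insertI2) blast
    qed (simp_all add: susp_linear)
  qed simp_all
qed

section \<open>Relations modulo cycles that miss a column\<close>

text \<open>
  The complex on the two rows \<open>i\<close> and \<open>t\<close> and three columns is a hexagon; this is the join of its
  fundamental cycle with \<open>w\<close>.
\<close>

definition hexagon :: "nat \<Rightarrow> nat \<Rightarrow> nat \<Rightarrow> nat \<Rightarrow> nat \<Rightarrow> chain \<Rightarrow> chain" where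
  "hexagon i t a b c w =
     wedge (i, a) (wedge (t, b) w) - wedge (i, b) (wedge (t, a) w)
     + (wedge (i, b) (wedge (t, c) w) - wedge (i, c) (wedge (t, b) w))
     + (wedge (i, c) (wedge (t, a) w) - wedge (i, a) (wedge (t, c) w))"

lemma hexagon_rook_cycles:
  assumes w: "w \<in> rook_cycles (S - {i, t}) (C - {a, b, c}) r"
    and it: "i \<in> S" "t \<in> S" "i \<noteq> t" and abc: "distinct [a, b, c]" "a \<in> C" "b \<in> C" "c \<in> C"
  shows "hexagon i t a b c w \<in> rook_cycles S C (Suc (Suc r))"
proof -
  note fin = rook_chains_finite_cells[OF rook_cyclesD(1)[OF w]]
  have chain: "wedge (i, x) (wedge (t, y) w) \<in> rook_chains S C (Suc (Suc r))"
    if "x \<in> {a, b, c}" "y \<in> {a, b, c}" "x \<noteq> y" for x y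
  proof -
    have "S - {i, t} = S - {i} - {t}" by auto
    then have "w \<in> rook_chains (S - {i} - {t}) (C - {x} - {y}) r"
      using that rook_cyclesD(1)[OF w] by (auto intro: rook_chains_mono)
    then show ?thesis
      using that it abc by (intro wedge_rook_chains) auto
  qed
  have bd: "bd (wedge (i, x) (wedge (t, y) w)) = wedge (t, y) w - wedge (i, x) w" for x y
    using rook_cyclesD(2)[OF w] by (simp add: bd_wedge fin finite_cells_wedge wedge_linear)
  show ?thesis
    using chain abc(1) unfolding hexagon_def rook_cycles_def
    by (auto simp: bd bd_linear intro!: rook_chains_closed)
qed

text \<open>
  In tensor notation, the antisymmetrisation of \<open>(b - a) \<otimes> (d - c)\<close> is a difference of two hexagons.
\<close>

lemma susp_exchange:
  "susp i a b (susp t c d w) = susp i c d (susp t a b w) + (hexagon i t a b d w - hexagon i t a b c w)"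
  by (simp add: susp_def hexagon_def wedge_linear algebra_simps)

text \<open>
  For commuting variables, \<open>(d - a) (c - b) = (c - a) (d - b) - (b - a) (d - c)\<close>; the failure of
  commutativity is one hexagon.
\<close>

lemma susp_three_term:
  "susp i a d (susp t b c w) = susp i a c (susp t b d w) - susp i a b (susp t c d w) - hexagon i t b c d w"
  by (simp add: susp_def hexagon_def wedge_linear algebra_simps)

definition column_deficient :: "nat set \<Rightarrow> nat set \<Rightarrow> nat \<Rightarrow> chain set" where
  "column_deficient S C r = (\<Union>j\<in>C. rook_cycles S (C - {j}) r)"

text \<open>
  The hexagon leaves one of the four columns of \<open>p\<close> and \<open>q\<close> free, and nothing else uses it.
\<close>

lemma multi_susp_hexagon_deficient:
  assumes "distinct (cols (xs @ p # q # ys))" "distinct [a, b, c]" "{a, b, c} \<subseteq> set (cols [p, q])"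
  shows "multi_susp s xs (hexagon (s + length xs) (Suc (s + length xs)) a b c
             (cross_sphere (Suc (Suc (s + length xs))) ys))
     \<in> column_deficient {s..<s + length (xs @ p # q # ys)} (set (cols (xs @ p # q # ys))) (length (xs @ p # q # ys))"
proof -
  obtain p1 p2 q1 q2 where pq: "p = (p1, p2)" "q = (q1, q2)"
    by (metis prod.exhaust)
  obtain d where d: "set (cols [p, q]) - {a, b, c} = {d}"
  proof -
    have "card (set (cols [p, q]) - {a, b, c}) = 1"
      using assms pq by (subst card_Diff_subset) auto
    then show ?thesis
      using that card_1_singletonE by blast
  qed
  let ?i = "s + length xs"
  define w where "w = cross_sphere (Suc (Suc ?i)) ys"
  have dist: "distinct (cols xs)" "distinct (cols ys)" "set (cols xs) \<inter> set (cols ys) = {}"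
    "set (cols [p, q]) \<inter> set (cols xs) = {}" "set (cols [p, q]) \<inter> set (cols ys) = {}"
    using assms(1) pq by auto
  have "w \<in> rook_cycles {Suc (Suc ?i)..<Suc (Suc ?i) + length ys} (set (cols ys)) (length ys)"
    unfolding w_def by (rule cross_sphere_rook_cycles[OF dist(2)])
  moreover have "{Suc (Suc ?i)..<Suc (Suc ?i) + length ys} = {?i..<?i + (2 + length ys)} - {?i, Suc ?i}"
    by auto
  moreover have "set (cols ys) = ({a, b, c} \<union> set (cols ys)) - {a, b, c}"
    using dist(5) assms(3) by auto
  ultimately have "w \<in> rook_cycles ({?i..<?i + (2 + length ys)} - {?i, Suc ?i})
      (({a, b, c} \<union> set (cols ys)) - {a, b, c}) (length ys)"
    by simp
  from hexagon_rook_cycles[OF this _ _ _ assms(2)]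
  have "hexagon ?i (Suc ?i) a b c w \<in> rook_cycles {?i..<?i + (2 + length ys)} ({a, b, c} \<union> set (cols ys)) (2 + length ys)"
    by simp
  from multi_susp_rook_cycles[OF this dist(1)]
  have *: "multi_susp s xs (hexagon ?i (Suc ?i) a b c w)
      \<in> rook_cycles {s..<s + (length xs + (2 + length ys))} ({a, b, c} \<union> set (cols ys) \<union> set (cols xs)) (length xs + (2 + length ys))"
    using dist(3,4) assms(3) by blast
  have "d \<in> set (cols [p, q])" "d \<notin> {a, b, c}"
    using d by blast+
  moreover from this have "d \<notin> set (cols xs)" "d \<notin> set (cols ys)"
    using dist(4,5) by blast+
  moreover have all: "set (cols (xs @ p # q # ys)) = set (cols xs) \<union> set (cols [p, q]) \<union> set (cols ys)"
    by (auto simp: pq)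
  ultimately have "{a, b, c} \<union> set (cols ys) \<union> set (cols xs) \<subseteq> set (cols (xs @ p # q # ys)) - {d}"
    using assms(3) by blast
  from rook_cycles_mono[OF * order_refl this]
  have "multi_susp s xs (hexagon ?i (Suc ?i) a b c w)
      \<in> rook_cycles {s..<s + length (xs @ p # q # ys)} (set (cols (xs @ p # q # ys)) - {d}) (length (xs @ p # q # ys))"
    by simp
  moreover have "d \<in> set (cols (xs @ p # q # ys))"
    using d all by blast
  ultimately show ?thesis
    unfolding column_deficient_def w_def by blast
qed

section \<open>Straightening\<close>

lemma adjacent_descent:
  fixes f :: "'a \<Rightarrow> nat"
  assumes "\<not> sorted (map f ps)"
  obtains xs p q ys where "ps = xs @ p # q # ys" "f q < f p"
proof -
  have "\<exists>xs p q ys. ps = xs @ p # q # ys \<and> f q < f p"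
    using assms
  proof (induction ps)
    case (Cons p ps)
    show ?case
    proof (cases "sorted (map f ps)")
      case False
      with Cons.IH show ?thesis
        by (metis append_Cons)
    next
      case True
      with Cons.prems obtain q ys where "ps = q # ys" "f q < f p"
        by (cases ps) (auto simp: not_le intro: order_trans)
      then show ?thesis
        by (metis append_Nil)
    qed
  qed simp
  then show thesis
    using that by blast
qed

abbreviation oriented :: "(nat \<times> nat) list \<Rightarrow> bool" where
  "oriented ps \<equiv> \<forall>p\<in>set ps. fst p < snd p"

text \<open>
  A standard list of pairs is a standard Young tableau with two columns of equal length, the pairs
  being its rows.
\<close>

definition standard :: "(nat \<times> nat) list \<Rightarrow> bool" where
  "standard ps \<longleftrightarrow> oriented ps \<and> sorted (map fst ps) \<and> sorted (map snd ps)"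

definition standard_or_deficient :: "nat \<Rightarrow> nat set \<Rightarrow> nat \<Rightarrow> chain set" where
  "standard_or_deficient s C k =
     {cross_sphere s ps |ps. length ps = k \<and> distinct (cols ps) \<and> set (cols ps) = C \<and> standard ps}
     \<union> column_deficient {s..<s + k} C k"

lemma cross_sphere_swap:
  assumes "distinct (cols (xs @ p # q # ys))"
  shows "cross_sphere s (xs @ p # q # ys) - cross_sphere s (xs @ q # p # ys) \<in>
    group_closure (column_deficient {s..<s + length (xs @ p # q # ys)}
      (set (cols (xs @ p # q # ys))) (length (xs @ p # q # ys)))" (is "_ \<in> group_closure ?D")
proof -
  obtain a b c d where pq: "p = (a, b)" "q = (c, d)"
    by (metis prod.exhaust)
  let ?h = "\<lambda>x y z. multi_susp s xs (hexagon (s + length xs) (Suc (s + length xs)) x y z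
      (cross_sphere (Suc (Suc (s + length xs))) ys))"
  have "?h a b d \<in> ?D" "?h a b c \<in> ?D"
    using assms pq by (intro multi_susp_hexagon_deficient; auto)+
  moreover have "cross_sphere s (xs @ p # q # ys) - cross_sphere s (xs @ q # p # ys) = ?h a b d - ?h a b c"
    by (simp add: pq multi_susp_append susp_exchange[of _ a b _ c d] multi_susp_linear)
  ultimately show ?thesis
    by (simp add: group_closure.base group_closure.diff)
qed

lemma cross_sphere_unnest:
  assumes "distinct (cols (xs @ (a, d) # (b, c) # ys))"
  shows "cross_sphere s (xs @ (a, d) # (b, c) # ys) - (cross_sphere s (xs @ (a, c) # (b, d) # ys)
      - cross_sphere s (xs @ (a, b) # (c, d) # ys)) \<in>
    group_closure (column_deficient {s..<s + length (xs @ (a, d) # (b, c) # ys)}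
      (set (cols (xs @ (a, d) # (b, c) # ys))) (length (xs @ (a, d) # (b, c) # ys)))"
    (is "_ \<in> group_closure ?D")
proof -
  let ?h = "multi_susp s xs (hexagon (s + length xs) (Suc (s + length xs)) b c d
      (cross_sphere (Suc (Suc (s + length xs))) ys))"
  have "?h \<in> ?D"
    using assms by (intro multi_susp_hexagon_deficient) auto
  moreover have "cross_sphere s (xs @ (a, d) # (b, c) # ys) - (cross_sphere s (xs @ (a, c) # (b, d) # ys)
      - cross_sphere s (xs @ (a, b) # (c, d) # ys)) = - ?h"
    by (simp add: multi_susp_append susp_three_term[of _ a d _ b c] multi_susp_linear)
  ultimately show ?thesis
    by (simp add: group_closure.base)
qed

text \<open>
  Termination of straightening: resolving a nested pair decreases the sum of the squared lengths,
  and exchanging two adjacent pairs with decreasing openers preserves it while decreasing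
  \<open>disorder\<close>, the sum of the openers weighted by their distance from the end of the list.
\<close>

fun spread :: "(nat \<times> nat) list \<Rightarrow> nat" where
  "spread [] = 0"
| "spread ((a, b) # ps) = (b - a)\<^sup>2 + spread ps"

fun disorder :: "(nat \<times> nat) list \<Rightarrow> nat" where
  "disorder [] = 0"
| "disorder (p # ps) = fst p * Suc (length ps) + disorder ps"

lemma spread_append: "spread (xs @ ys) = spread xs + spread ys"
  by (induction xs rule: spread.induct) auto

lemma disorder_append_less:
  "length ys = length zs \<Longrightarrow> disorder ys < disorder zs \<Longrightarrow> disorder (xs @ ys) < disorder (xs @ zs)"
  by (induction xs) auto

text \<open>
  A list that is not standard either has two adjacent pairs with decreasing openers, which can be
  exchanged, or its openers increase and two adjacent closers decrease, so that these two pairs are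
  nested.
\<close>

lemma straighten_oriented:
  assumes "length ps = k" "distinct (cols ps)" "set (cols ps) = C" "oriented ps"
  shows "cross_sphere s ps \<in> group_closure (standard_or_deficient s C k)"
  using assms
proof (induction ps rule: wf_induct_rule[OF wf_measures[of "[spread, disorder]"]])
  case (1 ps)
  have deficient: "x \<in> group_closure (standard_or_deficient s C k)"
    if "x \<in> group_closure (column_deficient {s..<s + k} C k)" for x
    using that by (rule group_closure_mono) (auto simp: standard_or_deficient_def)
  consider "\<not> sorted (map fst ps)" | "sorted (map fst ps)" "\<not> sorted (map snd ps)"
    | "standard ps"
    using 1 by (auto simp: standard_def)
  then show ?case
  proof cases
    case 1
    then obtain xs p q ys where ps: "ps = xs @ p # q # ys" and less: "fst q < fst p"
      by (rule adjacent_descent)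
    obtain a b c d where pq: "p = (a, b)" "q = (c, d)"
      by (metis prod.exhaust)
    let ?qs = "xs @ q # p # ys"
    have "disorder (q # p # ys) < disorder (p # q # ys)"
      using less by simp
    then have "(?qs, ps) \<in> measures [spread, disorder]"
      using disorder_append_less[of "q # p # ys" "p # q # ys" xs]
      by (simp add: ps spread_append pq)
    moreover have "length ?qs = k" "distinct (cols ?qs)" "set (cols ?qs) = C" "oriented ?qs"
      using "1.prems" by (auto simp: ps pq)
    ultimately have "cross_sphere s ?qs \<in> group_closure (standard_or_deficient s C k)"
      by (rule "1.IH")
    moreover have "cross_sphere s ps - cross_sphere s ?qs \<in> group_closure (standard_or_deficient s C k)"
      using deficient cross_sphere_swap[of xs p q ys s] "1.prems"(1-3) unfolding ps by metis
    ultimately show ?thesis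
      using group_closure_add by fastforce
  next
    case 2
    then obtain xs p q ys where ps: "ps = xs @ p # q # ys" and less: "snd q < snd p"
      using adjacent_descent by metis
    obtain a b c d where pq: "p = (a, d)" "q = (b, c)"
      by (metis prod.exhaust)
    have "a \<le> b"
      using 2(1) by (simp add: ps pq sorted_append)
    moreover have "a \<noteq> b"
      using "1.prems"(2) by (simp add: ps pq)
    ultimately have "a < b" "b < c" "c < d"
      using less "1.prems"(4) by (auto simp: ps pq)
    then obtain x y z where xyz: "b = a + x" "c = b + y" "d = c + z" "x > 0" "y > 0" "z > 0"
      using less_imp_add_positive by metis
    let ?q1 = "xs @ (a, c) # (b, d) # ys" and ?q2 = "xs @ (a, b) # (c, d) # ys"
    have "0 < x * z" "0 < x * y" "0 < y * z"
      using xyz by simp_all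
    \<comment> \<open>The spread decreases by \<open>2 x z\<close> and by \<open>2 y (x + y + z) + 2 x z\<close>.\<close>
    then have "spread ?q1 < spread ps" "spread ?q2 < spread ps"
      by (simp_all add: ps pq spread_append xyz power2_eq_square algebra_simps)
    then have "(?q1, ps) \<in> measures [spread, disorder]" "(?q2, ps) \<in> measures [spread, disorder]"
      by simp_all
    moreover have "length ?q1 = k" "distinct (cols ?q1)" "set (cols ?q1) = C" "oriented ?q1"
      "length ?q2 = k" "distinct (cols ?q2)" "set (cols ?q2) = C" "oriented ?q2"
      using "1.prems" \<open>a < b\<close> \<open>b < c\<close> \<open>c < d\<close> by (auto simp: ps pq)
    ultimately have "cross_sphere s ?q1 - cross_sphere s ?q2 \<in> group_closure (standard_or_deficient s C k)"
      using "1.IH" by (intro group_closure.diff) blast+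
    moreover have "cross_sphere s ps - (cross_sphere s ?q1 - cross_sphere s ?q2) \<in> group_closure (standard_or_deficient s C k)"
      using deficient cross_sphere_unnest[of xs a d b c ys s] "1.prems"(1-3) unfolding ps pq by metis
    ultimately show ?thesis
      using group_closure_add by fastforce
  next
    case 3
    then show ?thesis
      using "1.prems" unfolding standard_or_deficient_def by (intro group_closure.base insertI2 UnI1) blast
  qed
qed

text \<open>
  Exchanging the two members of a pair changes the sign of a suspension.
\<close>

lemma cross_sphere_orient:
  assumes "distinct (cols ps)"
  obtains qs where "length qs = length ps" "distinct (cols qs)" "set (cols qs) = set (cols ps)" "oriented qs"
    "\<And>s w. multi_susp s qs w = multi_susp s ps w \<or> multi_susp s qs w = - multi_susp s ps w"
proof -
  have "\<exists>qs. length qs = length ps \<and> distinct (cols qs) \<and> set (cols qs) = set (cols ps) \<and> oriented qs \<and>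
    (\<forall>s w. multi_susp s qs w = multi_susp s ps w \<or> multi_susp s qs w = - multi_susp s ps w)"
    using assms
  proof (induction ps rule: cols.induct)
    case (2 a b ps)
    then obtain qs where qs: "length qs = length ps" "distinct (cols qs)" "set (cols qs) = set (cols ps)" "oriented qs"
      "\<And>s w. multi_susp s qs w = multi_susp s ps w \<or> multi_susp s qs w = - multi_susp s ps w"
      by auto
    have swap: "susp s b a w = - susp s a b w" for s w
      by (simp add: susp_def)
    show ?case
    proof (cases "a < b")
      case True
      have "multi_susp s ((a, b) # qs) w = multi_susp s ((a, b) # ps) w \<or>
          multi_susp s ((a, b) # qs) w = - multi_susp s ((a, b) # ps) w" for s w
        using qs(5)[of "Suc s" w] by (auto simp: susp_linear)
      then show ?thesis
        using True qs(1-4) 2(2) by (intro exI[of _ "(a, b) # qs"]) auto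
    next
      case False
      have "multi_susp s ((b, a) # qs) w = multi_susp s ((a, b) # ps) w \<or>
          multi_susp s ((b, a) # qs) w = - multi_susp s ((a, b) # ps) w" for s w
        using qs(5)[of "Suc s" w] by (auto simp: susp_linear swap)
      then show ?thesis
        using False qs(1-4) 2(2) by (intro exI[of _ "(b, a) # qs"]) auto
    qed
  qed simp
  then show thesis
    using that by blast
qed

theorem top_cycles_straighten:
  assumes "finite C" "card C = 2 * k" "z \<in> rook_cycles {s..<s + k} C k"
  shows "z \<in> group_closure (standard_or_deficient s C k)"
proof -
  have "x \<in> group_closure (standard_or_deficient s C k)"
    if "x \<in> {cross_sphere s ps |ps. length ps = k \<and> distinct (cols ps) \<and> set (cols ps) = C}" for x
  proof -
    obtain ps where ps: "x = cross_sphere s ps" "length ps = k" "distinct (cols ps)" "set (cols ps) = C"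
      using \<open>x \<in> _\<close> by blast
    obtain qs where qs: "length qs = length ps" "distinct (cols qs)" "set (cols qs) = set (cols ps)" "oriented qs"
      "\<And>s w. multi_susp s qs w = multi_susp s ps w \<or> multi_susp s qs w = - multi_susp s ps w"
      using cross_sphere_orient[OF ps(3)] by metis
    have "cross_sphere s qs \<in> group_closure (standard_or_deficient s C k)"
      using qs ps by (intro straighten_oriented) auto
    then show ?thesis
      using qs(5)[of s "frag_of {}"] ps(1) by auto
  qed
  then show ?thesis
    using group_closure_map[where f = "\<lambda>x. x", OF top_cycles_generated_by_cross_spheres[OF assms]] by blast
qed

section \<open>Ballot sets and Catalan numbers\<close>

text \<open>
  Reading \<open>I\<close> as the positions of the votes for the second candidate, no initial segment contains a
  majority for that candidate.
\<close>

definition ballot :: "nat \<Rightarrow> nat \<Rightarrow> nat set set" where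
  "ballot n q = {I. I \<subseteq> {1..n} \<and> card I = q \<and> (\<forall>m\<le>n. 2 * card (I \<inter> {1..m}) \<le> m)}"

lemma finite_ballot [simp]: "finite (ballot n q)"
  by (rule finite_subset[of _ "Pow {1..n}"]) (auto simp: ballot_def)

lemma ballot_0: "ballot n 0 = {{}}"
  by (auto simp: ballot_def card_eq_0_iff finite_subset)

lemma ballot_Suc:
  assumes "2 * Suc q \<le> Suc n"
  shows "ballot (Suc n) (Suc q) = ballot n (Suc q) \<union> insert (Suc n) ` ballot n q"
proof (intro equalityI subsetI)
  fix I assume I: "I \<in> ballot (Suc n) (Suc q)"
  have fin: "finite I"
    using I finite_subset by (auto simp: ballot_def)
  show "I \<in> ballot n (Suc q) \<union> insert (Suc n) ` ballot n q"
  proof (cases "Suc n \<in> I")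
    case True
    have pre: "(I - {Suc n}) \<inter> {1..m} = I \<inter> {1..m}" if "m \<le> n" for m
      using that by auto
    have "I - {Suc n} \<in> ballot n q"
      using I True fin by (auto simp: ballot_def pre[simplified])
    then show ?thesis
      using True by (metis UnI2 image_eqI insert_Diff)
  next
    case False
    have "I \<subseteq> {1..n}"
    proof
      fix x assume "x \<in> I"
      then have "x \<in> {1..Suc n}" "x \<noteq> Suc n"
        using I False by (auto simp: ballot_def)
      then show "x \<in> {1..n}"
        by simp
    qed
    then show ?thesis
      using I by (auto simp: ballot_def)
  qed
next
  fix I assume "I \<in> ballot n (Suc q) \<union> insert (Suc n) ` ballot n q"
  then show "I \<in> ballot (Suc n) (Suc q)"
  proof
    assume I: "I \<in> ballot n (Suc q)"
    then have "I \<inter> {1..Suc n} = I" "card I = Suc q"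
      by (auto simp: ballot_def)
    then show ?thesis
      using I assms by (auto simp: ballot_def le_Suc_eq)
  next
    assume "I \<in> insert (Suc n) ` ballot n q"
    then obtain I' where I': "I = insert (Suc n) I'" "I' \<in> ballot n q"
      by blast
    have fin: "finite I'" and notin: "Suc n \<notin> I'" and sub: "I' \<subseteq> {1..n}"
      using I' finite_subset by (auto simp: ballot_def)
    have card: "card I = Suc q"
      using I' fin notin by (simp add: ballot_def)
    have "I \<inter> {1..Suc n} = I" "\<And>m. m \<le> n \<Longrightarrow> I \<inter> {1..m} = I' \<inter> {1..m}"
      using I' sub by auto
    then show ?thesis
      using I' assms card sub by (auto simp: ballot_def le_Suc_eq)
  qed
qed

text \<open>
  Ballot sets satisfy Pascal's recursion according to whether they contain the last element. The
  formula extends to the first case in which there are none, where it is the symmetry of the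
  binomial coefficients.
\<close>

lemma card_ballot_Suc:
  "2 * Suc q \<le> n + 1 \<Longrightarrow> card (ballot n (Suc q)) + (n choose q) = n choose Suc q"
proof (induction n arbitrary: q)
  case (Suc n)
  show ?case
  proof (cases "2 * Suc q \<le> Suc n")
    case False
    then have n: "n = 2 * q"
      using Suc.prems by simp
    have "2 * card (I \<inter> {1..Suc n}) > Suc n" if "I \<subseteq> {1..Suc n}" "card I = Suc q" for I
      using that n by (simp add: Int_absorb2)
    then have "ballot (Suc n) (Suc q) = {}"
      unfolding ballot_def using leD by blast
    moreover have "Suc n choose q = (Suc n choose Suc q)"
      using n binomial_symmetric[of q "Suc n"] by simp
    ultimately show ?thesis
      by simp
  next
    case True
    have "inj_on (insert (Suc n)) (ballot n q)"
      unfolding inj_on_def ballot_def by (auto simp: insert_ident) (metis Suc_n_not_le_n atLeastAtMost_iff insert_ident subsetD)+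
    moreover have "ballot n (Suc q) \<inter> insert (Suc n) ` ballot n q = {}"
      by (auto simp: ballot_def)
    ultimately have card: "card (ballot (Suc n) (Suc q)) = card (ballot n (Suc q)) + card (ballot n q)"
      by (simp add: ballot_Suc[OF True] card_Un_disjoint card_image)
    show ?thesis
    proof (cases q)
      case 0
      then show ?thesis
        using Suc.IH[of 0] True card by (simp add: ballot_0)
    next
      case (Suc p)
      then show ?thesis
        using Suc.IH[of q] Suc.IH[of p] True card by simp
    qed
  qed
qed simp

theorem card_ballot_catalan: "card (ballot (2 * k) k) = catalan k"
proof (cases k)
  case 0
  then show ?thesis
    by (simp add: ballot_0 catalan_def)
next
  case (Suc p)
  define b where "b = card (ballot (2 * k) k)"
  have b: "b + (2 * k choose p) = (2 * k choose k)"
    using card_ballot_Suc[of p "2 * k"] Suc by (simp add: b_def)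
  have "(k + 1) * (2 * k choose (k + 1)) = k * (2 * k choose k)"
    using binomial_absorb_comp[of "2 * k" k] binomial_absorption[of k "2 * k"] by auto
  then have "Suc k * (2 * k choose Suc k) = k * (2 * k choose k)"
    by simp
  moreover have "(2 * k choose Suc k) = (2 * k choose p)"
    using binomial_symmetric[of p "2 * k"] Suc by simp
  ultimately have "Suc k * (2 * k choose p) = k * (2 * k choose k)"
    by simp
  moreover have "Suc k * b + Suc k * (2 * k choose p) = Suc k * (2 * k choose k)"
    using b by (metis add_mult_distrib2)
  ultimately have "Suc k * b = (2 * k choose k)"
    by simp
  also have "\<dots> = Suc k * catalan k"
    using catalan_exact[of k] by simp
  finally have "b = catalan k"
    by (metis mult_left_cancel nat.distinct(1))
  then show ?thesis
    by (simp add: b_def)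
qed

text \<open>
  The standard list with set of closers \<open>I\<close>.
\<close>

definition ballot_pairs :: "nat \<Rightarrow> nat set \<Rightarrow> (nat \<times> nat) list" where
  "ballot_pairs n I = zip (sorted_list_of_set ({1..n} - I)) (sorted_list_of_set I)"

text \<open>
  Every closer in an initial segment brings along its opener.
\<close>

lemma standard_imp_ballot:
  assumes "distinct (cols ps)" "set (cols ps) = {1..2 * k}" "length ps = k" "standard ps"
  shows "snd ` set ps \<in> ballot (2 * k) k" "ps = ballot_pairs (2 * k) (snd ` set ps)"
proof -
  let ?I = "snd ` set ps"
  have dist: "distinct (map fst ps)" "distinct (map snd ps)" "fst ` set ps \<inter> ?I = {}"
    using assms(1) by (auto simp: distinct_cols_iff)
  have inj: "inj_on fst (set ps)" "inj_on snd (set ps)"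
    using dist by (auto simp: distinct_map)
  have "fst ` set ps = {1..2 * k} - ?I"
    using assms(2) dist(3) by (auto simp: set_cols)
  then have "sorted_list_of_set ({1..2 * k} - ?I) = map fst ps" "sorted_list_of_set ?I = map snd ps"
    using assms(4) dist sorted_list_of_set.idem_if_sorted_distinct[of "map fst ps"]
      sorted_list_of_set.idem_if_sorted_distinct[of "map snd ps"]
    by (auto simp: standard_def)
  then show "ps = ballot_pairs (2 * k) ?I"
    by (simp add: ballot_pairs_def zip_map_fst_snd)
  have "2 * card (?I \<inter> {1..m}) \<le> m" for m
  proof -
    let ?P = "{p \<in> set ps. snd p \<le> m}"
    have "snd p \<ge> 1" if "p \<in> set ps" for p
      using that assms(2) unfolding set_cols by fastforce
    then have "?I \<inter> {1..m} = snd ` ?P"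
      by auto
    moreover have "card (snd ` ?P) = card ?P" "card (fst ` ?P) = card ?P"
      by (intro card_image inj_on_subset[OF inj(2)] inj_on_subset[OF inj(1)]; blast)+
    moreover have "card (fst ` ?P \<union> snd ` ?P) = card (fst ` ?P) + card (snd ` ?P)"
      using dist(3) by (intro card_Un_disjoint) auto
    moreover have "fst ` ?P \<union> snd ` ?P \<subseteq> {1..m}"
    proof -
      have "fst p \<in> {1..m} \<and> snd p \<in> {1..m}" if "p \<in> ?P" for p
      proof -
        have "fst p \<in> {1..2 * k}" "snd p \<in> {1..2 * k}" "fst p < snd p"
          using that assms(2,4) unfolding set_cols standard_def by blast+
        then show ?thesis
          using that by auto
      qed
      then show ?thesis
        by blast
    qed
    then have "card (fst ` ?P \<union> snd ` ?P) \<le> m"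
      using card_mono[of "{1..m}"] by fastforce
    ultimately show ?thesis
      by simp
  qed
  moreover have "card ?I = k"
    using assms(3) dist(2) by (metis card_image distinct_card distinct_map length_map list.set_map)
  moreover have "?I \<subseteq> {1..2 * k}"
    using assms(2) by (auto simp: set_cols)
  ultimately show "?I \<in> ballot (2 * k) k"
    by (simp add: ballot_def)
qed

text \<open>
  If the \<open>i\<close>-th closer came before the \<open>i\<close>-th opener, the initial segment ending at this closer would
  contain more closers than openers.
\<close>

lemma ballot_pairs_standard:
  assumes "I \<in> ballot (2 * k) k"
  defines "ps \<equiv> ballot_pairs (2 * k) I"
  shows "length ps = k" "distinct (cols ps)" "set (cols ps) = {1..2 * k}" "standard ps"
    "snd ` set ps = I"
proof -
  define as where "as = sorted_list_of_set ({1..2 * k} - I)"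
  define bs where "bs = sorted_list_of_set I"
  have I: "I \<subseteq> {1..2 * k}" "card I = k" "finite I"
    using assms(1) finite_subset by (auto simp: ballot_def)
  have len: "length as = k" "length bs = k"
    using I by (simp_all add: as_def bs_def card_Diff_subset)
  have ps: "ps = zip as bs"
    by (simp add: ps_def ballot_pairs_def as_def bs_def)
  show "length ps = k"
    using len ps by simp
  have maps: "map fst ps = as" "map snd ps = bs"
    using len by (simp_all add: ps)
  have sets: "set as = {1..2 * k} - I" "set bs = I"
    using I by (simp_all add: as_def bs_def)
  have fs: "fst ` set ps = {1..2 * k} - I" "snd ` set ps = I"
    using maps sets by (metis list.set_map)+
  then show "snd ` set ps = I" "set (cols ps) = {1..2 * k}"
    using I by (auto simp: set_cols)
  show "distinct (cols ps)"
    unfolding distinct_cols_iff maps fs by (auto simp: as_def bs_def)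
  have sorted: "sorted as" "sorted bs" "distinct as" "distinct bs"
    by (simp_all add: as_def bs_def)
  have "as ! i < bs ! i" if i: "i < k" for i
  proof (rule ccontr)
    assume "\<not> as ! i < bs ! i"
    moreover have "as ! i \<in> {1..2 * k} - I" "bs ! i \<in> I"
      using i len sets nth_mem by metis+
    ultimately have less: "bs ! i < as ! i"
      by (metis DiffD2 linorder_neqE_nat)
    define m where "m = bs ! i"
    have m: "m \<le> 2 * k"
      using \<open>bs ! i \<in> I\<close> I(1) by (auto simp: m_def)
    have "(\<lambda>j. bs ! j) ` {..i} \<subseteq> I \<inter> {1..m}"
    proof (intro subsetI, elim imageE)
      fix x j assume j: "x = bs ! j" "j \<in> {..i}"
      then have "x \<in> I" "x \<le> m"
        using sets(2) len i sorted_nth_mono[OF sorted(2), of j i] nth_mem[of j bs] by (auto simp: m_def)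
      then show "x \<in> I \<inter> {1..m}"
        using I(1) by auto
    qed
    moreover have "card ((\<lambda>j. bs ! j) ` {..i}) = Suc i"
      using sorted(4) i len by (subst card_image) (auto simp: inj_on_def nth_eq_iff_index_eq)
    ultimately have 1: "Suc i \<le> card (I \<inter> {1..m})"
      by (metis card_mono finite_Int finite_atLeastAtMost)
    have "({1..2 * k} - I) \<inter> {1..m} \<subseteq> (\<lambda>j. as ! j) ` {..<i}"
    proof
      fix x assume x: "x \<in> ({1..2 * k} - I) \<inter> {1..m}"
      then obtain j where j: "j < k" "x = as ! j"
        using sets(1) len by (metis IntD1 in_set_conv_nth)
      have "\<not> i \<le> j"
        using sorted_nth_mono[OF sorted(1), of i j] j len less x by (auto simp: m_def)
      then show "x \<in> (\<lambda>j. as ! j) ` {..<i}"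
        using j by auto
    qed
    then have 2: "card (({1..2 * k} - I) \<inter> {1..m}) \<le> i"
      by (metis card_image_le card_lessThan card_mono finite_imageI finite_lessThan le_trans)
    have "{1..m} = I \<inter> {1..m} \<union> ({1..2 * k} - I) \<inter> {1..m}"
      using m by auto
    then have "card {1..m} = card (I \<inter> {1..m}) + card (({1..2 * k} - I) \<inter> {1..m})"
      by (subst card_Un_disjoint[symmetric]) auto
    moreover have "2 * card (I \<inter> {1..m}) \<le> m"
      using assms(1) m by (auto simp: ballot_def)
    ultimately show False
      using 1 2 by simp
  qed
  then have "oriented ps"
    using len by (auto simp: ps set_zip)
  then show "standard ps"
    using sorted maps by (simp add: standard_def)
qed

section \<open>Linear independence\<close>

definition evaluate :: "((nat \<times> nat) set \<Rightarrow> int) \<Rightarrow> chain \<Rightarrow> int" where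
  "evaluate \<phi> c = (\<Sum>\<sigma>\<in>Poly_Mapping.keys c. Poly_Mapping.lookup c \<sigma> * \<phi> \<sigma>)"

lemma evaluate_superset:
  assumes "finite A" "Poly_Mapping.keys c \<subseteq> A"
  shows "evaluate \<phi> c = (\<Sum>\<sigma>\<in>A. Poly_Mapping.lookup c \<sigma> * \<phi> \<sigma>)"
  unfolding evaluate_def using assms by (intro sum.mono_neutral_left) (auto simp: in_keys_iff)

lemma evaluate_add: "evaluate \<phi> (x + y) = evaluate \<phi> x + evaluate \<phi> y"
  using keys_add[of x y]
  by (simp add: evaluate_superset[of "Poly_Mapping.keys x \<union> Poly_Mapping.keys y"] lookup_add
      distrib_right sum.distrib)

lemma evaluate_diff: "evaluate \<phi> (x - y) = evaluate \<phi> x - evaluate \<phi> y"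
  using keys_diff[of x y]
  by (simp add: evaluate_superset[of "Poly_Mapping.keys x \<union> Poly_Mapping.keys y"] lookup_minus
      left_diff_distrib sum_subtractf)

lemma evaluate_0 [simp]: "evaluate \<phi> 0 = 0"
  by (simp add: evaluate_def)

lemma evaluate_cmul: "evaluate \<phi> (frag_cmul n x) = n * evaluate \<phi> x"
  by (simp add: evaluate_superset[of "Poly_Mapping.keys x"] keys_cmul sum_distrib_left mult.assoc)

lemma evaluate_sum: "finite A \<Longrightarrow> evaluate \<phi> (sum f A) = (\<Sum>i\<in>A. evaluate \<phi> (f i))"
  by (induction A rule: finite_induct) (auto simp: evaluate_add)

lemma evaluate_of [simp]: "evaluate \<phi> (frag_of \<sigma>) = \<phi> \<sigma>"
  by (simp add: evaluate_def)

lemma evaluate_cong: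
  "(\<And>\<sigma>. \<sigma> \<in> Poly_Mapping.keys c \<Longrightarrow> \<phi> \<sigma> = \<psi> \<sigma>) \<Longrightarrow> evaluate \<phi> c = evaluate \<psi> c"
  by (simp add: evaluate_def)

lemma evaluate_scale: "evaluate (\<lambda>\<sigma>. n * \<phi> \<sigma>) c = n * evaluate \<phi> c"
  by (simp add: evaluate_def sum_distrib_left mult.left_commute)

text \<open>
  The coefficient at \<open>\<Prod>\<^bsub>x\<in>K\<^esub> x\<close> of the Specht polynomial, the product of the differences \<open>b - a\<close> over all
  pairs, with columns as variables: it vanishes unless \<open>K\<close> contains exactly one member of each pair.
\<close>

fun choice_sign :: "(nat \<times> nat) list \<Rightarrow> nat set \<Rightarrow> int" where
  "choice_sign [] K = 1"
| "choice_sign ((a, b) # ps) K = (of_bool (b \<in> K) - of_bool (a \<in> K)) * choice_sign ps K"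

lemma choice_sign_cong:
  "K \<inter> set (cols ps) = L \<inter> set (cols ps) \<Longrightarrow> choice_sign ps K = choice_sign ps L"
proof (induction ps rule: cols.induct)
  case (2 a b ps)
  have "x \<in> K \<longleftrightarrow> x \<in> L" if "x \<in> set (cols ((a, b) # ps))" for x
    using 2(2) that by blast
  moreover from this have "choice_sign ps K = choice_sign ps L"
    by (intro 2(1)) auto
  ultimately show ?case
    by simp
qed simp

lemma choice_sign_closers: "distinct (cols ps) \<Longrightarrow> choice_sign ps (snd ` set ps) = 1"
proof (induction ps rule: cols.induct)
  case (2 a b ps)
  have "choice_sign ps (snd ` set ((a, b) # ps)) = choice_sign ps (snd ` set ps)"
    using 2(2) by (intro choice_sign_cong) (auto simp: set_cols)
  then show ?case
    using 2 by (auto simp: set_cols)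
qed simp

text \<open>
  The leading monomial of the Specht polynomial is the product of the closers, monomials being
  compared by the sum of their columns.
\<close>

lemma choice_sign_sum_le:
  assumes "distinct (cols ps)" "oriented ps" "K \<subseteq> set (cols ps)" "choice_sign ps K \<noteq> 0"
  shows "\<Sum>K \<le> \<Sum>(snd ` set ps) \<and> (\<Sum>K = \<Sum>(snd ` set ps) \<longrightarrow> K = snd ` set ps)"
  using assms
proof (induction ps arbitrary: K rule: cols.induct)
  case (2 a b ps)
  define L where "L = K - {a, b}"
  have "choice_sign ps K = choice_sign ps L"
    using 2(2) by (intro choice_sign_cong) (auto simp: L_def)
  then have IH: "\<Sum>L \<le> \<Sum>(snd ` set ps)" "\<Sum>L = \<Sum>(snd ` set ps) \<Longrightarrow> L = snd ` set ps"
    using 2(1)[of L] 2(2-5) by (auto simp: L_def)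
  have fin: "finite L"
    using 2(4) finite_subset[of L "set (cols ((a, b) # ps))"] by (auto simp: L_def)
  have "b \<notin> snd ` set ps" "a < b"
    using 2(2,3) by (auto simp: set_cols)
  then have closers: "\<Sum>(snd ` set ((a, b) # ps)) = b + \<Sum>(snd ` set ps)"
    by simp
  have notin: "a \<notin> L" "b \<notin> L"
    by (simp_all add: L_def)
  have "(b \<in> K) \<noteq> (a \<in> K)"
    using 2(5) by auto
  then consider "K = insert b L" | "K = insert a L"
    by (auto simp: L_def)
  then show ?case
  proof cases
    case 1
    then have "\<Sum>K = b + \<Sum>L"
      using fin notin by simp
    then show ?thesis
      using IH closers 1 by auto
  next
    case 2
    then have "\<Sum>K = a + \<Sum>L"
      using fin notin by simp
    then show ?thesis
      using IH closers \<open>a < b\<close> by auto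
  qed
qed simp

text \<open>
  A set with more elements than there are pairs contains some pair. Removing an element outside
  this pair leaves the pair complete and contributes nothing; removing one or the other member of
  the pair gives opposite contributions.
\<close>

lemma choice_sign_facet_sum:
  assumes "distinct (cols ps)" "K \<subseteq> set (cols ps)" "length ps < card K"
  shows "(\<Sum>j\<in>K. choice_sign ps (K - {j})) = 0"
  using assms
proof (induction ps arbitrary: K rule: cols.induct)
  case 1
  then show ?case by simp
next
  case (2 a b ps)
  have ab: "a \<noteq> b" "a \<notin> set (cols ps)" "b \<notin> set (cols ps)" "distinct (cols ps)"
    using 2(2) by auto
  have fin: "finite K"
    using 2(3) finite_subset by blast
  define L where "L = K - {a, b}"
  have L: "finite L" "L \<subseteq> set (cols ps)" "a \<notin> L" "b \<notin> L"
    using fin 2(3) by (auto simp: L_def)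
  show ?case
  proof (cases "a \<in> K \<and> b \<in> K")
    case True
    then have K: "K = insert a (insert b L)"
      by (auto simp: L_def)
    let ?f = "\<lambda>j. choice_sign ((a, b) # ps) (K - {j})"
    have "(\<Sum>j\<in>K. ?f j) = (\<Sum>j\<in>insert a (insert b L). ?f j)"
      using K by simp
    also have "\<dots> = ?f a + (?f b + (\<Sum>j\<in>L. ?f j))"
      using ab(1) L by (simp del: choice_sign.simps)
    also have "(\<Sum>j\<in>L. ?f j) = 0"
      using True L by (intro sum.neutral) auto
    also have "?f a = choice_sign ps (K - {a})"
      using True ab(1) by simp
    also have "?f b = - choice_sign ps (K - {b})"
      using True ab(1) by simp
    also have "choice_sign ps (K - {a}) = choice_sign ps (K - {b})"
      using ab by (intro choice_sign_cong) auto
    finally show ?thesis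
      by simp
  next
    case False
    have card: "length ps < card L"
    proof -
      have "card K \<le> Suc (card L)"
      proof (cases "a \<in> K")
        case True
        then have "K = insert a L"
          using False by (auto simp: L_def)
        then show ?thesis
          using L by simp
      next
        case False
        then have "K \<subseteq> insert b L"
          by (auto simp: L_def)
        then have "card K \<le> card (insert b L)"
          using L(1) by (intro card_mono) auto
        then show ?thesis
          using L by simp
      qed
      then show ?thesis
        using 2(4) by simp
    qed
    let ?e = "of_bool (b \<in> K) - of_bool (a \<in> K) :: int"
    have "(\<Sum>j\<in>K. choice_sign ((a, b) # ps) (K - {j})) = (\<Sum>j\<in>L. choice_sign ((a, b) # ps) (K - {j}))"
      using fin False by (intro sum.mono_neutral_right) (auto simp: L_def)
    also have "\<dots> = (\<Sum>j\<in>L. ?e * choice_sign ps (L - {j}))"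
    proof (intro sum.cong refl)
      fix j assume j: "j \<in> L"
      have "choice_sign ps (K - {j}) = choice_sign ps (L - {j})"
        using ab by (intro choice_sign_cong) (auto simp: L_def)
      moreover have "j \<noteq> a" "j \<noteq> b"
        using j L by auto
      ultimately show "choice_sign ((a, b) # ps) (K - {j}) = ?e * choice_sign ps (L - {j})"
        by simp
    qed
    also have "\<dots> = 0"
      using 2(1)[OF ab(4) L(2) card] by (simp flip: sum_distrib_left)
    finally show ?thesis .
  qed
qed

lemma sum_Pow_insert:
  assumes "finite A" "x \<notin> A"
  shows "(\<Sum>K\<in>Pow (insert x A). f K) = (\<Sum>K\<in>Pow A. f K + f (insert x K))"
proof -
  have "inj_on (insert x) (Pow A)"
    using assms(2) by (auto simp: inj_on_def)
  moreover have "Pow A \<inter> insert x ` Pow A = {}"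
    using assms(2) by auto
  ultimately show ?thesis
    using assms(1) by (simp add: Pow_insert sum.union_disjoint sum.reindex sum.distrib)
qed

text \<open>
  A vertex in a row above all others comes first in the order of the vertices, so the cone
  introduces no sign.
\<close>

lemma evaluate_wedge_first_row:
  assumes "\<And>\<tau> u. \<tau> \<in> Poly_Mapping.keys w \<Longrightarrow> u \<in> \<tau> \<Longrightarrow> s < fst u"
  shows "evaluate \<phi> (wedge (s, b) w) = evaluate (\<lambda>\<tau>. \<phi> (insert (s, b) \<tau>)) w"
proof -
  have "Poly_Mapping.keys w \<subseteq> {\<tau>. \<forall>u\<in>\<tau>. s < fst u}"
    using assms by blast
  then show ?thesis
  proof (induction w rule: frag_induction)
    case (one \<tau>)
    have "{u \<in> \<tau>. edge_less u (s, b)} = {}" "(s, b) \<notin> \<tau>"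
      using one by (fastforce simp: edge_less_def)+
    then have "vsign (s, b) \<tau> = 1" "(s, b) \<notin> \<tau>"
      unfolding vsign_def by (simp_all only: card.empty power_0 not_False_eq_True)
    then show ?case
      by (simp add: wedge_of)
  qed (simp_all add: wedge_linear evaluate_diff)
qed

lemma evaluate_cross_sphere:
  assumes "distinct (cols ps)"
  shows "evaluate (\<lambda>\<sigma>. g (snd ` \<sigma>)) (cross_sphere s ps)
    = (\<Sum>K\<in>Pow (set (cols ps)). choice_sign ps K * g K)"
  using assms
proof (induction ps arbitrary: s g rule: cols.induct)
  case (2 a b ps)
  let ?w = "cross_sphere (Suc s) ps" and ?A = "set (cols ps)"
  have ab: "a \<noteq> b" "a \<notin> ?A" "b \<notin> ?A" "distinct (cols ps)"
    using 2(2) by auto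
  have "evaluate (\<lambda>\<sigma>. g (snd ` \<sigma>)) (wedge (s, j) ?w) = (\<Sum>K\<in>Pow ?A. choice_sign ps K * g (insert j K))" for j
  proof -
    have "s < fst u" if "\<tau> \<in> Poly_Mapping.keys ?w" "u \<in> \<tau>" for \<tau> u
      using that cross_sphere_rook_cycles[OF ab(4), of "Suc s"]
      by (fastforce simp: rook_cycles_def rook_chains_def rook_faces_def)
    then show ?thesis
      using 2(1)[OF ab(4), of "\<lambda>K. g (insert j K)" "Suc s"] by (simp add: evaluate_wedge_first_row)
  qed
  then have "evaluate (\<lambda>\<sigma>. g (snd ` \<sigma>)) (cross_sphere s ((a, b) # ps))
      = (\<Sum>K\<in>Pow ?A. choice_sign ps K * g (insert b K) - choice_sign ps K * g (insert a K))"
    by (simp add: susp_def evaluate_diff sum_subtractf)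
  also have "\<dots> = (\<Sum>K\<in>Pow (insert a (insert b ?A)). choice_sign ((a, b) # ps) K * g K)"
  proof -
    let ?h = "\<lambda>K. choice_sign ((a, b) # ps) K * g K"
    have "choice_sign ps K * g (insert b K) - choice_sign ps K * g (insert a K)
        = ?h K + ?h (insert a K) + (?h (insert b K) + ?h (insert a (insert b K)))" if "K \<in> Pow ?A" for K
    proof -
      have "a \<notin> K" "b \<notin> K"
        using that ab by auto
      moreover have "choice_sign ps (insert b K) = choice_sign ps K" "choice_sign ps (insert a K) = choice_sign ps K"
        using ab by (auto intro!: choice_sign_cong)
      ultimately show ?thesis
        using ab(1) by simp
    qed
    moreover have "(\<Sum>K\<in>Pow (insert a (insert b ?A)). h K)
        = (\<Sum>K\<in>Pow ?A. h K + h (insert a K) + (h (insert b K) + h (insert a (insert b K))))"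
      for h :: "nat set \<Rightarrow> int"
      using ab by (simp add: sum_Pow_insert)
    ultimately show ?thesis
      by (simp del: choice_sign.simps)
  qed
  finally show ?case
    by simp
qed simp

text \<open>
  The sum of the occupied rows is, up to a constant, minus the empty row. Its parity is the sign
  that makes the map forgetting the rows compatible with boundaries.
\<close>

definition matching_cocycle :: "(nat \<times> nat) list \<Rightarrow> (nat \<times> nat) set \<Rightarrow> int" where
  "matching_cocycle ps \<sigma> = (- 1) ^ (\<Sum>u\<in>\<sigma>. fst u) * choice_sign ps (snd ` \<sigma>)"

lemma nonattacking_inj_on:
  assumes "nonattacking \<sigma>"
  shows "inj_on fst \<sigma>" "inj_on snd \<sigma>"
  using nonattackingD[OF assms] by (auto simp: inj_on_def)

text \<open>
  In a cell with \<open>k + 1\<close> rooks on \<open>k + 1\<close> rows, a rook in row \<open>i\<close> has \<open>i - 1\<close> smaller vertices, so the sign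
  of the corresponding facet and the sign of its empty row \<open>i\<close> combine to a constant.
\<close>

lemma matching_cocycle_boundary:
  assumes "distinct (cols ps)" "length ps = k"
    and "c \<in> rook_chains {1..Suc k} (set (cols ps)) (Suc k)"
  shows "evaluate (matching_cocycle ps) (bd c) = 0"
proof -
  have "Poly_Mapping.keys c \<subseteq> rook_faces {1..Suc k} (set (cols ps)) (Suc k)"
    using assms(3) by (simp add: rook_chains_def)
  then show ?thesis
  proof (induction c rule: frag_induction)
    case (one \<sigma>)
    have na: "nonattacking \<sigma>" and fin: "finite \<sigma>" and card: "card \<sigma> = Suc k"
      and sub: "\<sigma> \<subseteq> {1..Suc k} \<times> set (cols ps)"
      using one by (auto simp: rook_faces_def)
    have rows: "fst ` \<sigma> = {1..Suc k}"
      using one by (intro rook_face_rows) auto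
    note inj = nonattacking_inj_on[OF na]
    let ?K = "snd ` \<sigma>" and ?S = "\<Sum>u\<in>\<sigma>. fst u"
    have term_v: "vsign v \<sigma> * matching_cocycle ps (\<sigma> - {v}) = - ((- 1) ^ ?S) * choice_sign ps (?K - {snd v})"
      if v: "v \<in> \<sigma>" for v
    proof -
      have v1: "fst v \<in> {1..Suc k}"
        using v rows by blast
      have "edge_less u v \<longleftrightarrow> fst u < fst v" if "u \<in> \<sigma>" for u
        using inj_onD[OF inj(1) _ that v] by (auto simp: edge_less_def split_beta)
      then have "{u \<in> \<sigma>. edge_less u v} = {u \<in> \<sigma>. fst u < fst v}"
        by blast
      moreover have "fst ` {u \<in> \<sigma>. fst u < fst v} = {1..<fst v}"
      proof -
        have "fst ` {u \<in> \<sigma>. fst u < fst v} = fst ` \<sigma> \<inter> {..<fst v}"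
          by auto
        then show ?thesis
          using v1 rows by auto
      qed
      moreover have "card (fst ` {u \<in> \<sigma>. fst u < fst v}) = card {u \<in> \<sigma>. fst u < fst v}"
        using inj(1) by (intro card_image) (auto simp: inj_on_def)
      ultimately have "vsign v \<sigma> = (- 1) ^ (fst v - 1)"
        by (simp add: vsign_def)
      moreover have "?S = fst v + (\<Sum>u\<in>\<sigma> - {v}. fst u)"
        using fin v by (simp add: sum.remove)
      moreover have "snd ` (\<sigma> - {v}) = ?K - {snd v}"
        using inj(2) v by (auto simp: inj_on_def)
      moreover obtain i where "fst v = Suc i"
        using v1 by (cases "fst v") auto
      ultimately show ?thesis
        by (simp add: matching_cocycle_def power_add flip: power_mult_distrib)
    qed
    have "evaluate (matching_cocycle ps) (bd (frag_of \<sigma>)) = (\<Sum>v\<in>\<sigma>. - ((- 1) ^ ?S) * choice_sign ps (?K - {snd v}))"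
      unfolding bd_of evaluate_sum[OF fin] using term_v by (intro sum.cong) (simp_all add: evaluate_cmul)
    also have "\<dots> = - ((- 1) ^ ?S) * (\<Sum>j\<in>?K. choice_sign ps (?K - {j}))"
      using inj(2) by (simp add: sum.reindex sum_distrib_left)
    also have "(\<Sum>j\<in>?K. choice_sign ps (?K - {j})) = 0"
      using assms sub card inj(2) by (intro choice_sign_facet_sum) (auto simp: card_image)
    finally show ?case
      by simp
  qed (simp_all add: bd_linear evaluate_diff)
qed

lemma matching_cocycle_cross_sphere:
  assumes "distinct (cols ps)"
  shows "evaluate (matching_cocycle qs) (cross_sphere s ps) = (- 1) ^ (\<Sum>{s..<s + length ps})
    * (\<Sum>K\<in>Pow (set (cols ps)). choice_sign ps K * choice_sign qs K)"
proof -
  have "matching_cocycle qs \<sigma> = (- 1) ^ (\<Sum>{s..<s + length ps}) * choice_sign qs (snd ` \<sigma>)"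
    if "\<sigma> \<in> Poly_Mapping.keys (cross_sphere s ps)" for \<sigma>
  proof -
    have \<sigma>: "\<sigma> \<in> rook_faces {s..<s + length ps} (set (cols ps)) (length ps)"
      using that cross_sphere_rook_cycles[OF assms, of s] by (auto simp: rook_cycles_def rook_chains_def)
    then have "fst ` \<sigma> = {s..<s + length ps}"
      by (intro rook_face_rows) auto
    moreover have "(\<Sum>u\<in>\<sigma>. fst u) = \<Sum>(fst ` \<sigma>)"
      using \<sigma> nonattacking_inj_on(1) by (subst sum.reindex) (auto simp: rook_faces_def)
    ultimately show ?thesis
      by (simp add: matching_cocycle_def)
  qed
  then have "evaluate (matching_cocycle qs) (cross_sphere s ps)
      = evaluate (\<lambda>\<sigma>. (- 1) ^ (\<Sum>{s..<s + length ps}) * choice_sign qs (snd ` \<sigma>)) (cross_sphere s ps)"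
    by (rule evaluate_cong)
  then show ?thesis
    by (simp add: evaluate_scale evaluate_cross_sphere[OF assms])
qed

abbreviation ballot_sphere :: "nat \<Rightarrow> nat set \<Rightarrow> chain" where
  "ballot_sphere k I \<equiv> cross_sphere 1 (ballot_pairs (2 * k) I)"

text \<open>
  If a combination of the spheres bounds, then the corresponding combination \<open>F\<close> of Specht
  polynomials is orthogonal to each of them, hence to itself, and so it vanishes. Among the spheres
  with non-zero coefficient, take one whose leading monomial \<open>J\<close> is maximal: then \<open>F\<close> has the
  coefficient of this sphere at \<open>J\<close>.
\<close>

theorem ballot_spheres_independent:
  assumes y: "y \<in> rook_chains {1..Suc k} {1..2 * k} (Suc k)"
    and eq: "bd y = (\<Sum>I\<in>ballot (2 * k) k. frag_cmul (c I) (ballot_sphere k I))"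
    and I: "I \<in> ballot (2 * k) k"
  shows "c I = 0"
proof -
  let ?B = "ballot (2 * k) k" and ?T = "ballot_pairs (2 * k)" and ?P = "Pow {1..2 * k}"
  define F where "F K = (\<Sum>J\<in>?B. c J * choice_sign (?T J) K)" for K
  note T = ballot_pairs_standard
  have "(\<Sum>K\<in>?P. F K * choice_sign (?T L) K) = 0" if L: "L \<in> ?B" for L
  proof -
    let ?e = "(- 1) ^ (\<Sum>{1..<1 + k}) :: int"
    have "0 = evaluate (matching_cocycle (?T L)) (bd y)"
      using matching_cocycle_boundary[OF T(2,1)[OF L]] y T(3)[OF L] by simp
    also have "\<dots> = (\<Sum>J\<in>?B. c J * evaluate (matching_cocycle (?T L)) (ballot_sphere k J))"
      unfolding eq by (simp add: evaluate_sum evaluate_cmul)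
    also have "\<dots> = (\<Sum>J\<in>?B. c J * (?e * (\<Sum>K\<in>?P. choice_sign (?T J) K * choice_sign (?T L) K)))"
      using T by (intro sum.cong refl) (simp add: matching_cocycle_cross_sphere)
    also have "\<dots> = ?e * (\<Sum>K\<in>?P. F K * choice_sign (?T L) K)"
      unfolding F_def sum_distrib_left sum_distrib_right
      by (subst sum.swap) (simp add: mult_ac)
    finally show ?thesis
      by simp
  qed
  then have "0 = (\<Sum>L\<in>?B. c L * (\<Sum>K\<in>?P. F K * choice_sign (?T L) K))"
    by simp
  also have "\<dots> = (\<Sum>K\<in>?P. F K * F K)"
  proof -
    have "F K * F K = (\<Sum>L\<in>?B. c L * (F K * choice_sign (?T L) K))" for K
      by (subst (2) F_def) (simp add: sum_distrib_left mult_ac)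
    then show ?thesis
      unfolding sum_distrib_left by (subst sum.swap) simp
  qed
  finally have "\<forall>K\<in>?P. F K * F K = 0"
    by (subst (asm) eq_commute, subst (asm) sum_nonneg_eq_0_iff) auto
  then have F: "F K = 0" if "K \<subseteq> {1..2 * k}" for K
    using that by simp
  show ?thesis
  proof (rule ccontr)
    assume "c I \<noteq> 0"
    let ?N = "{J \<in> ?B. c J \<noteq> 0}"
    have "finite ((\<lambda>J. \<Sum>J) ` ?N)" "(\<lambda>J. \<Sum>J) ` ?N \<noteq> {}"
      using I \<open>c I \<noteq> 0\<close> by auto
    from Max_in[OF this] obtain J where J: "J \<in> ?B" "c J \<noteq> 0" and "\<Sum>J = Max ((\<lambda>J. \<Sum>J) ` ?N)"
      by auto
    then have max: "\<Sum>L \<le> \<Sum>J" if "L \<in> ?B" "c L \<noteq> 0" for L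
      using that by (simp add: Max_ge)
    have sub: "J \<subseteq> {1..2 * k}"
      using J by (simp add: ballot_def)
    have "c L * choice_sign (?T L) J = 0" if L: "L \<in> ?B" "L \<noteq> J" for L
    proof (rule ccontr)
      assume nz: "c L * choice_sign (?T L) J \<noteq> 0"
      have "\<Sum>J \<le> \<Sum>L \<and> (\<Sum>J = \<Sum>L \<longrightarrow> J = L)"
        using choice_sign_sum_le[of "?T L" J] T[OF L(1)] sub nz by (simp add: standard_def)
      then show False
        using max[OF L(1)] nz L(2) by auto
    qed
    then have "(\<Sum>L\<in>?B - {J}. c L * choice_sign (?T L) J) = 0"
      by (intro sum.neutral) blast
    then have "F J = c J * choice_sign (?T J) J"
      unfolding F_def using J(1) by (simp add: sum.remove)
    also have "choice_sign (?T J) J = 1"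
      using choice_sign_closers[OF T(2)[OF J(1)]] T(5)[OF J(1)] by simp
    finally show False
      using F[OF sub] J(2) by simp
  qed
qed

section \<open>The homology group\<close>

text \<open>
  The links of the vertices of the row \<open>t\<close> are cycles one below the top dimension, on boards that are
  wide enough for them to bound.
\<close>

lemma cycle_homologous_to_fewer_rows:
  assumes z: "z \<in> rook_cycles (insert t S) C (Suc r)" and S: "finite S" "t \<notin> S"
    and size: "Suc r = card S" "2 * card S \<le> card C"
  obtains y where "y \<in> rook_chains (insert t S) C (Suc (Suc r))" "z + bd y \<in> rook_cycles S C (Suc r)"
proof -
  have finC: "finite C"
    using size by (auto intro: card_ge_0_finite)
  have S_eq: "insert t S - {t} = S"
    using S by simp
  have "\<exists>w \<in> rook_chains S (C - {j}) (Suc r). bd w = slice (t, j) z" if "j \<in> C" for j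
    using that S size finC slice_rook_cycles[OF z, of t j]
    by (intro rook_cycles_bound) (simp_all add: S_eq)
  then obtain w where w: "\<And>j. j \<in> C \<Longrightarrow> w j \<in> rook_chains S (C - {j}) (Suc r)"
    "\<And>j. j \<in> C \<Longrightarrow> bd (w j) = slice (t, j) z"
    by metis
  have off: "slice (t, l) (w j) = 0" if "j \<in> C" for l j
    using w(1)[OF that] S(2) slice_off_board by blast
  have V: "finite ({t} \<times> C)" "{t} \<times> C \<subseteq> insert t S \<times> C"
    using finC by auto
  have "\<And>v. v \<in> {t} \<times> C \<Longrightarrow> w (snd v) \<in> rook_chains (insert t S - {fst v}) (C - {snd v}) (Suc r)"
    "\<And>v. v \<in> {t} \<times> C \<Longrightarrow> bd (w (snd v)) = slice v z"
    "\<And>u v. u \<in> {t} \<times> C \<Longrightarrow> v \<in> {t} \<times> C \<Longrightarrow> slice u (w (snd v)) = 0"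
    using w off by (auto simp: S_eq)
  note elim = eliminate_vertices[OF z V this]
  define y where "y = (\<Sum>v\<in>{t} \<times> C. wedge v (w (snd v)))"
  have y: "y \<in> rook_chains (insert t S) C (Suc (Suc r))" "z + bd y \<in> rook_cycles (insert t S) C (Suc r)"
    unfolding y_def by (rule elim(1), assumption+) (rule elim(2), assumption+)
  have row: "slice (t, j) (z + bd y) = 0" if "j \<in> C" for j
    unfolding y_def using that by (intro elim(3)) auto
  have "z + bd y \<in> rook_chains S C (Suc r)"
    using rook_chains_delete_row[OF rook_cyclesD(1)[OF y(2)] row] by (simp add: S_eq)
  then have "z + bd y \<in> rook_cycles S C (Suc r)"
    using rook_cyclesD(2)[OF y(2)] by (simp add: rook_cycles_def)
  then show thesis
    using y(1) that by blast
qed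

text \<open>
  In a row \<open>t\<close> not used by the cycle, the vertex in the missing column is joinable to all of it.
\<close>

lemma column_deficient_bounds:
  assumes "x \<in> column_deficient S C r" "t \<notin> S"
  obtains y where "y \<in> rook_chains (insert t S) C (Suc r)" "bd y = x"
proof -
  obtain j where j: "j \<in> C" "x \<in> rook_cycles S (C - {j}) r"
    using assms(1) by (auto simp: column_deficient_def)
  have "insert t S - {t} = S"
    using assms(2) by simp
  then have "wedge (t, j) x \<in> rook_chains (insert t S) C (Suc r)"
    using j rook_cyclesD(1)[OF j(2)] by (intro wedge_rook_chains) auto
  moreover have "bd (wedge (t, j) x) = x"
    using rook_cyclesD[OF j(2)] bd_wedge rook_chains_finite_cells by (simp add: wedge_linear)
  ultimately show thesis
    using that by blast
qed

text \<open>
  The rows are \<open>1, \<dots>, k\<close> after clearing the last row, which then serves to bound the cycles that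
  straightening leaves over.
\<close>

theorem ballot_spheres_generate:
  assumes "k > 0" and z: "z \<in> rook_cycles {1..Suc k} {1..2 * k} k"
  shows "\<exists>c. z - (\<Sum>I\<in>ballot (2 * k) k. frag_cmul (c I) (ballot_sphere k I))
           \<in> bd ` rook_chains {1..Suc k} {1..2 * k} (Suc k)"
proof -
  let ?C = "{1..2 * k}" and ?B = "ballot (2 * k) k"
  let ?R = "rook_chains {1..Suc k} ?C (Suc k)"
  define gen where "gen x \<longleftrightarrow> (\<exists>c. \<exists>y\<in>?R. x - (\<Sum>I\<in>?B. frag_cmul (c I) (ballot_sphere k I)) = bd y)" for x
  have rows: "insert (Suc k) {1..k} = {1..Suc k}" "{1..<1 + k} = {1..k}"
    by auto
  have gen_diff: "gen (x - x')" if "gen x" "gen x'" for x x'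
  proof -
    obtain c y where y: "y \<in> ?R" "x - (\<Sum>I\<in>?B. frag_cmul (c I) (ballot_sphere k I)) = bd y"
      using \<open>gen x\<close> unfolding gen_def by blast
    moreover obtain c' y' where y': "y' \<in> ?R" "x' - (\<Sum>I\<in>?B. frag_cmul (c' I) (ballot_sphere k I)) = bd y'"
      using \<open>gen x'\<close> unfolding gen_def by blast
    ultimately have "bd (y - y') = x - x' - (\<Sum>I\<in>?B. frag_cmul (c I - c' I) (ballot_sphere k I))"
      by (simp add: bd_linear frag_cmul_diff_distrib sum_subtractf flip: y(2) y'(2))
    moreover have "y - y' \<in> ?R"
      using y(1) y'(1) by (rule rook_chains_closed)
    ultimately show ?thesis
      unfolding gen_def by (intro exI[of _ "\<lambda>I. c I - c' I"] bexI[of _ "y - y'"]) simp_all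
  qed
  have gen_bd: "gen (bd y)" if "y \<in> ?R" for y
    unfolding gen_def using that by (intro exI[of _ "\<lambda>_. 0"] bexI[of _ y]) simp_all
  have gen_basis: "gen (ballot_sphere k J)" if "J \<in> ?B" for J
  proof -
    have "(\<Sum>I\<in>?B. frag_cmul (if I = J then 1 else 0) (ballot_sphere k I)) = (\<Sum>I\<in>?B. if I = J then ballot_sphere k I else 0)"
      by (intro sum.cong) auto
    then show ?thesis
      unfolding gen_def using that
      by (intro exI[of _ "\<lambda>I. if I = J then 1 else 0"] bexI[of _ 0]) (simp_all add: bd_linear rook_chains_closed)
  qed
  have gen_straight: "gen x" if "x \<in> group_closure (standard_or_deficient 1 ?C k)" for x
    using that
  proof (induction rule: group_closure.induct)
    case (base x)
    then consider "x = 0" | ps where "x = cross_sphere 1 ps" "length ps = k" "distinct (cols ps)" "set (cols ps) = ?C" "standard ps"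
      | "x \<in> column_deficient {1..k} ?C k"
      unfolding standard_or_deficient_def rows by blast
    then show ?case
    proof cases
      case 1
      then show ?thesis
        using gen_bd[of 0] by (simp add: bd_linear rook_chains_closed)
    next
      case 2
      then show ?thesis
        using standard_imp_ballot[of ps k] gen_basis by metis
    next
      case 3
      then obtain y where "y \<in> ?R" "bd y = x"
        using column_deficient_bounds[of x "{1..k}" ?C k "Suc k"] rows(1) by auto
      then show ?thesis
        using gen_bd by blast
    qed
  qed (rule gen_diff)
  obtain r where r: "k = Suc r"
    using \<open>k > 0\<close> gr0_implies_Suc by blast
  have z': "z \<in> rook_cycles (insert (Suc k) {1..k}) ?C (Suc r)"
    using z by (simp only: rows(1) flip: r)
  have "Suc r = card {1..k}" "2 * card {1..k} \<le> card ?C" "finite {1..k}" "Suc k \<notin> {1..k}"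
    using r by simp_all
  from cycle_homologous_to_fewer_rows[OF z' this(3,4,1,2)]
  obtain y where "y \<in> rook_chains (insert (Suc k) {1..k}) ?C (Suc (Suc r))"
    "z + bd y \<in> rook_cycles {1..k} ?C (Suc r)"
    by metis
  then have y: "y \<in> ?R" "z + bd y \<in> rook_cycles {1..k} ?C k"
    by (simp_all only: rows(1) flip: r)
  then have "z + bd y \<in> rook_cycles {1..<1 + k} ?C k"
    by (simp only: rows)
  then have "gen (z + bd y)"
    by (intro gen_straight top_cycles_straighten) auto
  then have "gen (z + bd y - bd y)"
    using gen_diff gen_bd y(1) by blast
  then show ?thesis
    unfolding gen_def by (auto simp: image_iff)
qed

lemma ballot_sphere_cycle:
  assumes "I \<in> ballot (2 * k) k"
  shows "ballot_sphere k I \<in> rook_cycles {1..Suc k} {1..2 * k} k"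
proof -
  note T = ballot_pairs_standard[OF assms]
  have "ballot_sphere k I \<in> rook_cycles {1..<1 + k} {1..2 * k} k"
    using cross_sphere_rook_cycles[OF T(2), of 1] T(1,3) by simp
  then show ?thesis
    by (rule rook_cycles_mono) auto
qed

lemma carrier_chain_group:
  assumes "p + 1 = int r"
  shows "carrier (simplicial_chain_group (chessboard_complex m n) p) = rook_chains {1..m} {1..n} r"
proof -
  have "{\<sigma> \<in> chessboard_complex m n. int (card \<sigma>) = p + 1} = rook_faces {1..m} {1..n} r"
    using assms finite_subset[of _ "{1..m} \<times> {1..n}"]
    by (auto simp: chessboard_complex_def rook_faces_def nonattacking_def)
  then show ?thesis
    by (auto simp: simplicial_chain_group_def rook_chains_def)
qed

lemma cycle_group:
  fixes m n :: nat
  assumes "p + 1 = int r"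
  defines "Z \<equiv> simplicial_cycle_group edge_less (chessboard_complex m n) p"
  shows "carrier Z = rook_cycles {1..m} {1..n} r" "\<And>x y. x \<otimes>\<^bsub>Z\<^esub> y = x + y" "comm_group Z"
proof -
  let ?G = "simplicial_chain_group (chessboard_complex m n) p"
  let ?K = "kernel ?G (simplicial_chain_group (chessboard_complex m n) (p - 1)) bd"
  have K: "?K = rook_cycles {1..m} {1..n} r"
    unfolding kernel_def carrier_chain_group[OF assms(1)]
    by (auto simp: simplicial_chain_group_def rook_cycles_def)
  have comm: "comm_group ?G"
    by (simp add: simplicial_chain_group_def abelian_free_Abelian_group)
  then interpret G: comm_group ?G .
  have "subgroup ?K ?G"
  proof (rule G.subgroupI)
    show "?K \<subseteq> carrier ?G"
      by (auto simp: kernel_def)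
    show "?K \<noteq> {}"
      unfolding K using rook_cycles_closed(1) by blast
    show "inv\<^bsub>?G\<^esub> a \<in> ?K" if "a \<in> ?K" for a
    proof -
      have "inv\<^bsub>?G\<^esub> a = - a"
        using that by (auto simp: kernel_def simplicial_chain_group_def)
      then show ?thesis
        using that unfolding K by (simp add: rook_cycles_closed)
    qed
    show "a \<otimes>\<^bsub>?G\<^esub> b \<in> ?K" if "a \<in> ?K" "b \<in> ?K" for a b
    proof -
      have "a \<otimes>\<^bsub>?G\<^esub> b = a + b"
        by (simp add: simplicial_chain_group_def)
      then show ?thesis
        using that unfolding K by (simp add: rook_cycles_closed)
    qed
  qed
  then show "carrier Z = rook_cycles {1..m} {1..n} r"
    unfolding Z_def simplicial_cycle_group_def K[symmetric]
    by (rule subgroup.carrier_subgroup_generated_subgroup)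
  show "x \<otimes>\<^bsub>Z\<^esub> y = x + y" for x y
    by (simp add: Z_def simplicial_cycle_group_def simplicial_chain_group_def subgroup_generated_def
        free_Abelian_group_def)
  show "comm_group Z"
    unfolding Z_def simplicial_cycle_group_def by (rule G.abelian_subgroup_generated[OF comm])
qed

lemma quotient_free_of_basis:
  fixes Z :: "('c \<Rightarrow>\<^sub>0 int) monoid" and b :: "'i \<Rightarrow> 'c \<Rightarrow>\<^sub>0 int"
  assumes Z: "comm_group Z" "\<And>x y. x \<otimes>\<^bsub>Z\<^esub> y = x + y" and B: "subgroup B Z" and A: "finite A"
    and closed: "\<And>c. (\<Sum>i\<in>A. frag_cmul (c i) (b i)) \<in> carrier Z"
    and gen: "\<And>z. z \<in> carrier Z \<Longrightarrow> \<exists>c. z - (\<Sum>i\<in>A. frag_cmul (c i) (b i)) \<in> B"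
    and indep: "\<And>c i. (\<Sum>i\<in>A. frag_cmul (c i) (b i)) \<in> B \<Longrightarrow> i \<in> A \<Longrightarrow> c i = 0"
  shows "Z Mod B \<cong> product_group {..<card A} (\<lambda>_. integer_group)"
proof -
  interpret Z: comm_group Z
    by (rule Z(1))
  interpret B: normal B Z
    by (rule Z.subgroup_imp_normal[OF B])
  let ?P = "product_group {..<card A} (\<lambda>_. integer_group)"
  obtain h where h: "bij_betw h A {..<card A}"
    using ex_bij_betw_finite_nat[OF A] by (auto simp: atLeast0LessThan)
  define comb where "comb c = (\<Sum>i\<in>A. frag_cmul (c i) (b i))" for c
  define \<theta> where "\<theta> x = B #>\<^bsub>Z\<^esub> comb (x \<circ> h)" for x
  have comb_carrier: "comb c \<in> carrier Z" for c
    using closed by (simp add: comb_def)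
  have "\<theta> \<in> hom ?P (Z Mod B)"
  proof (rule homI)
    show "\<theta> x \<in> carrier (Z Mod B)" for x
      using comb_carrier by (auto simp: \<theta>_def carrier_FactGroup)
    fix x y
    have "comb ((\<lambda>i\<in>{..<card A}. x i + y i) \<circ> h) = comb (x \<circ> h) + comb (y \<circ> h)"
      unfolding comb_def sum.distrib[symmetric] using bij_betwE[OF h]
      by (intro sum.cong) (auto simp: frag_cmul_distrib)
    then show "\<theta> (x \<otimes>\<^bsub>?P\<^esub> y) = \<theta> x \<otimes>\<^bsub>Z Mod B\<^esub> \<theta> y"
      using B.rcos_sum[OF comb_carrier comb_carrier] by (simp add: \<theta>_def Z(2))
  qed
  then interpret \<theta>: group_hom ?P "Z Mod B" \<theta>
    by (simp add: group_hom_def group_hom_axioms_def B.factorgroup_is_group)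
  have "\<theta> \<in> iso ?P (Z Mod B)"
    unfolding \<theta>.iso_iff
  proof (intro conjI subsetI ballI impI)
    fix x assume x: "x \<in> carrier ?P" "\<theta> x = \<one>\<^bsub>Z Mod B\<^esub>"
    then have "comb (x \<circ> h) \<in> B"
      using Z.coset_join1[OF _ comb_carrier B] by (simp add: \<theta>_def)
    then have "x (h i) = 0" if "i \<in> A" for i
      using indep[of "x \<circ> h"] that by (simp add: comb_def)
    then have "x j = 0" if "j < card A" for j
      using h that by (metis bij_betw_imp_surj_on imageE lessThan_iff)
    then show "x = \<one>\<^bsub>?P\<^esub>"
      using x(1) by (auto simp: PiE_def extensional_def restrict_def fun_eq_iff)
  next
    fix y assume "y \<in> carrier (Z Mod B)"
    then obtain z where z: "z \<in> carrier Z" "y = B #>\<^bsub>Z\<^esub> z"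
      by (auto simp: carrier_FactGroup)
    obtain c where c: "z - comb c \<in> B"
      using gen[OF z(1)] by (auto simp: comb_def)
    define x where "x = (\<lambda>j\<in>{..<card A}. c (inv_into A h j))"
    have "comb (x \<circ> h) = comb c"
      unfolding comb_def using h bij_betwE[OF h]
      by (intro sum.cong) (auto simp: x_def bij_betw_inv_into_left)
    moreover have "z \<in> B #>\<^bsub>Z\<^esub> comb c"
      using Z.rcosI[OF c B.subset comb_carrier[of c]] by (simp add: Z(2))
    then have "B #>\<^bsub>Z\<^esub> comb c = B #>\<^bsub>Z\<^esub> z"
      by (rule Z.repr_independence[OF _ comb_carrier B])
    ultimately have "y = \<theta> x"
      using z(2) by (simp add: \<theta>_def)
    moreover have "x \<in> carrier ?P"
      by (simp add: x_def)
    ultimately show "y \<in> \<theta> ` carrier ?P"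
      by blast
  qed
  then have "?P \<cong> Z Mod B"
    by (auto simp: is_iso_def)
  then show ?thesis
    using group.iso_sym by fastforce
qed

lemma rook_cycles_cmul: "x \<in> rook_cycles S C r \<Longrightarrow> frag_cmul n x \<in> rook_cycles S C r"
  using keys_cmul[of n x] by (auto simp: rook_cycles_def rook_chains_def bd_cmul)

theorem chessboard_homology_free:
  assumes "k > 0"
  shows "chessboard_homology (int k - 1) (Suc k) (2 * k)
    \<cong> product_group {..<catalan k} (\<lambda>_. integer_group)"
proof -
  let ?p = "int k - 1" and ?\<Delta> = "chessboard_complex (Suc k) (2 * k)"
  let ?Z = "simplicial_cycle_group edge_less ?\<Delta> ?p"
  let ?B = "simplicial_boundary_set edge_less ?\<Delta> ?p"
  let ?C = "{1..2 * k}" and ?R = "rook_chains {1..Suc k} {1..2 * k} (Suc k)"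
  have Z: "carrier ?Z = rook_cycles {1..Suc k} ?C k" "\<And>x y. x \<otimes>\<^bsub>?Z\<^esub> y = x + y" "comm_group ?Z"
    using cycle_group[of ?p k "Suc k" "2 * k"] by simp_all
  interpret Z: comm_group ?Z
    by (rule Z(3))
  have B: "?B = bd ` ?R"
    unfolding simplicial_boundary_set_def using carrier_chain_group[of "?p + 1" "Suc k"] by simp
  have one: "\<one>\<^bsub>?Z\<^esub> = 0"
    using Z.r_one[OF Z.one_closed] by (simp add: Z(2))
  have sub: "?B \<subseteq> carrier ?Z"
    unfolding B Z(1) using bd_rook_cycles by blast
  have "subgroup ?B ?Z"
  proof (rule Z.subgroupI[OF sub])
    show "?B \<noteq> {}"
      unfolding B using rook_chains_closed(1) by blast
    show "x \<otimes>\<^bsub>?Z\<^esub> y \<in> ?B" if "x \<in> ?B" "y \<in> ?B" for x y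
      using that unfolding B Z(2) by (auto simp: rook_chains_closed simp flip: bd_linear(2))
    show "inv\<^bsub>?Z\<^esub> x \<in> ?B" if x: "x \<in> ?B" for x
    proof -
      have "x \<in> carrier ?Z" "- x \<in> carrier ?Z"
        using subsetD[OF sub x] unfolding Z(1) by (auto intro: rook_cycles_closed)
      then have "inv\<^bsub>?Z\<^esub> x = - x"
        by (intro Z.inv_equality) (simp_all add: Z(2) one)
      then show ?thesis
        using x unfolding B by (auto simp: rook_chains_closed simp flip: bd_linear(4))
    qed
  qed
  then have "?Z Mod ?B \<cong> product_group {..<card (ballot (2 * k) k)} (\<lambda>_. integer_group)"
  proof (rule quotient_free_of_basis[OF Z(3,2), where b = "ballot_sphere k"])
    show "(\<Sum>I\<in>ballot (2 * k) k. frag_cmul (c I) (ballot_sphere k I)) \<in> carrier ?Z" for c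
      unfolding Z(1) by (intro rook_cycles_sum rook_cycles_cmul ballot_sphere_cycle)
    show "\<exists>c. z - (\<Sum>I\<in>ballot (2 * k) k. frag_cmul (c I) (ballot_sphere k I)) \<in> ?B" if "z \<in> carrier ?Z" for z
      unfolding B using that ballot_spheres_generate[OF assms] by (simp only: Z(1))
    show "c I = 0" if h: "(\<Sum>I\<in>ballot (2 * k) k. frag_cmul (c I) (ballot_sphere k I)) \<in> ?B"
      "I \<in> ballot (2 * k) k" for c I
    proof -
      obtain y where y: "(\<Sum>I\<in>ballot (2 * k) k. frag_cmul (c I) (ballot_sphere k I)) = bd y" "y \<in> ?R"
        by (rule imageE[OF h(1)[unfolded B]])
      show ?thesis
        by (rule ballot_spheres_independent[OF y(2) y(1)[symmetric] h(2)])
    qed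
  qed simp
  then show ?thesis
    by (simp add: chessboard_homology_def reduced_simplicial_homology_def card_ballot_catalan)
qed

theorem theorem7p2:
  fixes m n :: nat
  assumes "m > 0" and "n > 0" and "n = 2 * m - 2"
  shows "chessboard_homology (nu m n) m n
           \<cong> product_group {..<catalan (m - 1)} (\<lambda>_. integer_group)"
proof -
  define k where "k = m - 1"
  have k: "k > 0" "m = Suc k" "n = 2 * k"
    using assms by (auto simp: k_def)
  have "(m + n + 1) div 3 = k"
    using k by simp
  then have "nu m n = int k - 1"
    using k by (simp add: nu_def)
  then show ?thesis
    using chessboard_homology_free[OF k(1)] k by simp
qed

end
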